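(* For every sentence $\phi$ in the (second-order) language whose only non-logical primitive is $\in$: $\mathsf{BST}\vdash\phi$ if and only if $\mathsf{BLT}\vdash\phi$.
   Context: Second-order logic with Comprehension. For a set $a$, its absolute complement is $\overline{a}=\{x:x\notin a\}$ (if it exists). $\mathrm{bpot}(a)=\{x:\exists c(c\in a\wedge c\notin c\wedge(x\subseteq c\vee\overline{x}\subseteq c))\}$ (if it exists). A boolean-history is a set $h$ with $h\notin h$ and $x=\mathrm{bpot}(x\cap h)$ for all $x\in h$; a boolean-level is $\mathrm{bpot}(h)$ for a boolean-history $h$. $\mathsf{BLT}$ has axioms: Extensionality; Complements: $\forall a\exists c(c=\overline{a}\wedge(a\notin a\leftrightarrow c\in c))$; Separation$_\notin$: $\forall F\forall a(a\notin a\to\exists b(b\notin b\wedge\forall x(x\in b\leftrightarrow(F(x)\wedge x\in a))))$; Stratification$_\notin$: every $a$ with $a\notin a$ is a subset of some boolean-level. $\mathsf{BST}$ is two-sorted (sets $a,b,x$; stages $\mathbf{r},\mathbf{s},\mathbf{t}$) with primitives $\in$ (sets), $<$ (stages), $a\sqsubset\mathbf{s}$ ("$a$ is found at $\mathbf{s}$"), and unary predicates $\mathrm{Low}$, $\mathrm{High}$ on sets. "$a$ is found before $\mathbf{s}$" means $\exists\mathbf{r}(a\sqsubset\mathbf{r}\wedge\mathbf{r}<\mathbf{s})$. Axioms: Extensionality; Order ($<$ transitive); Staging ($\forall a\exists\mathbf{s}\,a\sqsubset\mathbf{s}$); Cases ($\forall a(\mathrm{Low}(a)\vee\mathrm{High}(a))$);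 Priority$_L$: if $\mathrm{Low}(a)$ and $a\sqsubset\mathbf{s}$ then every $x\in a$ is found before $\mathbf{s}$; Priority$_H$: if $\mathrm{High}(a)$ and $a\sqsubset\mathbf{s}$ then every $x\notin a$ is found before $\mathbf{s}$; Specification$_L$: for all $F,\mathbf{s}$, if every $F$ is found before $\mathbf{s}$ then there is $a$ with $\mathrm{Low}(a)$, $a\sqsubset\mathbf{s}$, $\forall x(F(x)\leftrightarrow x\in a)$; Specification$_H$: likewise with $\mathrm{High}(a)$, $a\sqsubset\mathbf{s}$, $\forall x(F(x)\leftrightarrow x\notin a)$. *)

theory Defs
  imports Main
begin

datatype srt = SSet | SStage
datatype prim = PMem | PLess | PFound | PLow | PHigh

fun prim_sig :: "prim \<Rightarrow> srt list" where
  "prim_sig PMem = [SSet, SSet]"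
| "prim_sig PLess = [SStage, SStage]"
| "prim_sig PFound = [SSet, SStage]"
| "prim_sig PLow = [SSet]"
| "prim_sig PHigh = [SSet]"

type_synonym var1 = "nat \<times> srt"        \<comment> \<open>first-order variable: name and sort\<close>
type_synonym var2 = "nat \<times> srt list"   \<comment> \<open>relation variable: name and arity (list of sorts)\<close>
type_synonym lang = "srt set \<times> prim set"

datatype fm =
    Prim prim "var1 list"
  | Eq var1 var1
  | RApp var2 "var1 list"
  | Bot
  | Imp fm fm
  | All1 var1 fm
  | All2 var2 fm

fun wf :: "lang \<Rightarrow> fm \<Rightarrow> bool" where
  "wf L (Prim p xs) = (p \<in> snd L \<and> map snd xs = prim_sig p \<and> set (prim_sig p) \<subseteq> fst L)"
| "wf L (Eq x y) = (snd x = snd y \<and> snd x \<in> fst L)"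
| "wf L (RApp X xs) = (map snd xs = snd X \<and> set (snd X) \<subseteq> fst L)"
| "wf L Bot = True"
| "wf L (Imp p q) = (wf L p \<and> wf L q)"
| "wf L (All1 x p) = (snd x \<in> fst L \<and> wf L p)"
| "wf L (All2 X p) = (set (snd X) \<subseteq> fst L \<and> wf L p)"

fun fv1 :: "fm \<Rightarrow> var1 set" where
  "fv1 (Prim p xs) = set xs"
| "fv1 (Eq x y) = {x, y}"
| "fv1 (RApp X xs) = set xs"
| "fv1 Bot = {}"
| "fv1 (Imp p q) = fv1 p \<union> fv1 q"
| "fv1 (All1 x p) = fv1 p - {x}"
| "fv1 (All2 X p) = fv1 p"

fun fv2 :: "fm \<Rightarrow> var2 set" where
  "fv2 (Prim p xs) = {}"
| "fv2 (Eq x y) = {}"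
| "fv2 (RApp X xs) = {X}"
| "fv2 Bot = {}"
| "fv2 (Imp p q) = fv2 p \<union> fv2 q"
| "fv2 (All1 x p) = fv2 p"
| "fv2 (All2 X p) = fv2 p - {X}"

definition sentence :: "fm \<Rightarrow> bool" where
  "sentence p \<longleftrightarrow> fv1 p = {} \<and> fv2 p = {}"

definition rn :: "'a \<Rightarrow> 'a \<Rightarrow> 'a \<Rightarrow> 'a" where
  "rn x y z = (if z = x then y else z)"

fun subst1 :: "var1 \<Rightarrow> var1 \<Rightarrow> fm \<Rightarrow> fm" where
  "subst1 x y (Prim p xs) = Prim p (map (rn x y) xs)"
| "subst1 x y (Eq u v) = Eq (rn x y u) (rn x y v)"
| "subst1 x y (RApp X xs) = RApp X (map (rn x y) xs)"
| "subst1 x y Bot = Bot"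
| "subst1 x y (Imp p q) = Imp (subst1 x y p) (subst1 x y q)"
| "subst1 x y (All1 z p) = (if z = x then All1 z p else All1 z (subst1 x y p))"
| "subst1 x y (All2 X p) = All2 X (subst1 x y p)"

fun substable1 :: "var1 \<Rightarrow> var1 \<Rightarrow> fm \<Rightarrow> bool" where
  "substable1 x y (Imp p q) = (substable1 x y p \<and> substable1 x y q)"
| "substable1 x y (All1 z p) = (x \<notin> fv1 (All1 z p) \<or> (z \<noteq> y \<and> substable1 x y p))"
| "substable1 x y (All2 X p) = substable1 x y p"
| "substable1 x y _ = True"

fun subst2 :: "var2 \<Rightarrow> var2 \<Rightarrow> fm \<Rightarrow> fm" where
  "subst2 X Y (RApp Z xs) = RApp (rn X Y Z) xs"
| "subst2 X Y (Imp p q) = Imp (subst2 X Y p) (subst2 X Y q)"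
| "subst2 X Y (All1 z p) = All1 z (subst2 X Y p)"
| "subst2 X Y (All2 Z p) = (if Z = X then All2 Z p else All2 Z (subst2 X Y p))"
| "subst2 X Y p = p"

fun substable2 :: "var2 \<Rightarrow> var2 \<Rightarrow> fm \<Rightarrow> bool" where
  "substable2 X Y (Imp p q) = (substable2 X Y p \<and> substable2 X Y q)"
| "substable2 X Y (All1 z p) = substable2 X Y p"
| "substable2 X Y (All2 Z p) = (X \<notin> fv2 (All2 Z p) \<or> (Z \<noteq> Y \<and> substable2 X Y p))"
| "substable2 X Y _ = True"

definition Neg :: "fm \<Rightarrow> fm" where "Neg p = Imp p Bot"
definition Or :: "fm \<Rightarrow> fm \<Rightarrow> fm" where "Or p q = Imp (Neg p) q"
definition And :: "fm \<Rightarrow> fm \<Rightarrow> fm" where "And p q = Neg (Imp p (Neg q))"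
definition Iff :: "fm \<Rightarrow> fm \<Rightarrow> fm" where "Iff p q = And (Imp p q) (Imp q p)"
definition Ex1 :: "var1 \<Rightarrow> fm \<Rightarrow> fm" where "Ex1 x p = Neg (All1 x (Neg p))"
definition Ex2 :: "var2 \<Rightarrow> fm \<Rightarrow> fm" where "Ex2 X p = Neg (All2 X (Neg p))"
definition Alls :: "var1 list \<Rightarrow> fm \<Rightarrow> fm" where "Alls xs p = foldr All1 xs p"

inductive_set lax :: "lang \<Rightarrow> fm set" for L :: lang where
  ax_k: "\<lbrakk>wf L p; wf L q\<rbrakk> \<Longrightarrow> Imp p (Imp q p) \<in> lax L"
| ax_s: "\<lbrakk>wf L p; wf L q; wf L r\<rbrakk> \<Longrightarrow>
          Imp (Imp p (Imp q r)) (Imp (Imp p q) (Imp p r)) \<in> lax L"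
| ax_dn: "wf L p \<Longrightarrow> Imp (Neg (Neg p)) p \<in> lax L"
| ax_inst1: "\<lbrakk>wf L (All1 x p); snd y = snd x; substable1 x y p\<rbrakk> \<Longrightarrow>
          Imp (All1 x p) (subst1 x y p) \<in> lax L"
| ax_dist1: "\<lbrakk>wf L (All1 x (Imp p q))\<rbrakk> \<Longrightarrow>
          Imp (All1 x (Imp p q)) (Imp (All1 x p) (All1 x q)) \<in> lax L"
| ax_vac1: "\<lbrakk>wf L (All1 x p); x \<notin> fv1 p\<rbrakk> \<Longrightarrow> Imp p (All1 x p) \<in> lax L"
| ax_inst2: "\<lbrakk>wf L (All2 X p); snd Y = snd X; substable2 X Y p\<rbrakk> \<Longrightarrow>
          Imp (All2 X p) (subst2 X Y p) \<in> lax L"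
| ax_dist2: "\<lbrakk>wf L (All2 X (Imp p q))\<rbrakk> \<Longrightarrow>
          Imp (All2 X (Imp p q)) (Imp (All2 X p) (All2 X q)) \<in> lax L"
| ax_vac2: "\<lbrakk>wf L (All2 X p); X \<notin> fv2 p\<rbrakk> \<Longrightarrow> Imp p (All2 X p) \<in> lax L"
| ax_refl: "snd x \<in> fst L \<Longrightarrow> Eq x x \<in> lax L"
| ax_leib: "\<lbrakk>wf L p; snd x = snd z; snd y = snd z; snd z \<in> fst L;
             substable1 z x p; substable1 z y p\<rbrakk> \<Longrightarrow>
          Imp (Eq x y) (Imp (subst1 z x p) (subst1 z y p)) \<in> lax L"
| ax_comp: "\<lbrakk>wf L p; set (snd X) \<subseteq> fst L; map snd xs = snd X; distinct xs;
             X \<notin> fv2 p\<rbrakk> \<Longrightarrow>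
          Ex2 X (Alls xs (Iff (RApp X xs) p)) \<in> lax L"

inductive prv :: "lang \<Rightarrow> fm set \<Rightarrow> fm \<Rightarrow> bool" for L :: lang and T :: "fm set" where
  prv_ax: "p \<in> lax L \<Longrightarrow> prv L T p"
| prv_hyp: "p \<in> T \<Longrightarrow> prv L T p"
| prv_mp: "\<lbrakk>prv L T (Imp p q); prv L T p\<rbrakk> \<Longrightarrow> prv L T q"
| prv_gen1: "\<lbrakk>prv L T p; snd x \<in> fst L; \<forall>q\<in>T. x \<notin> fv1 q\<rbrakk> \<Longrightarrow> prv L T (All1 x p)"
| prv_gen2: "\<lbrakk>prv L T p; set (snd X) \<subseteq> fst L; \<forall>q\<in>T. X \<notin> fv2 q\<rbrakk> \<Longrightarrow> prv L T (All2 X p)"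

definition L_mem :: lang where "L_mem = ({SSet}, {PMem})"
definition L_BST :: lang where "L_BST = (UNIV, UNIV)"

definition sv :: "nat \<Rightarrow> var1" where "sv n = (n, SSet)"
definition tv :: "nat \<Rightarrow> var1" where "tv n = (n, SStage)"
definition Fv :: "nat \<Rightarrow> var2" where "Fv n = (n, [SSet])"

definition mem :: "var1 \<Rightarrow> var1 \<Rightarrow> fm" where "mem x y = Prim PMem [x, y]"
definition less :: "var1 \<Rightarrow> var1 \<Rightarrow> fm" where "less r s = Prim PLess [r, s]"
definition found :: "var1 \<Rightarrow> var1 \<Rightarrow> fm" where "found a s = Prim PFound [a, s]"
definition low :: "var1 \<Rightarrow> fm" where "low a = Prim PLow [a]"
definition high :: "var1 \<Rightarrow> fm" where "high a = Prim PHigh [a]"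

definition subs :: "var1 \<Rightarrow> var1 \<Rightarrow> var1 \<Rightarrow> fm" where
  "subs u v w = All1 w (Imp (mem w u) (mem w v))"
definition csubs :: "var1 \<Rightarrow> var1 \<Rightarrow> var1 \<Rightarrow> fm" where
  "csubs u v w = All1 w (Imp (Neg (mem w u)) (mem w v))"

definition BLT_ext :: fm where
  "BLT_ext = All1 (sv 0) (All1 (sv 1)
     (Imp (All1 (sv 2) (Iff (mem (sv 2) (sv 0)) (mem (sv 2) (sv 1)))) (Eq (sv 0) (sv 1))))"

definition BLT_compl :: fm where
  "BLT_compl = All1 (sv 0) (Ex1 (sv 1) (And
     (All1 (sv 2) (Iff (mem (sv 2) (sv 1)) (Neg (mem (sv 2) (sv 0)))))
     (Iff (Neg (mem (sv 0) (sv 0))) (mem (sv 1) (sv 1)))))"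

definition BLT_sep :: fm where
  "BLT_sep = All2 (Fv 0) (All1 (sv 0) (Imp (Neg (mem (sv 0) (sv 0)))
     (Ex1 (sv 1) (And (Neg (mem (sv 1) (sv 1)))
        (All1 (sv 2) (Iff (mem (sv 2) (sv 1)) (And (RApp (Fv 0) [sv 2]) (mem (sv 2) (sv 0)))))))))"

text \<open>"y satisfies the bpot condition relative to c": c \<notin> c and (y \<subseteq> c or complement(y) \<subseteq> c).
  Variables: y = sv 4, c = sv 5, w = sv 6.\<close>
definition bcond :: fm where
  "bcond = And (Neg (mem (sv 5) (sv 5)))
                (Or (subs (sv 4) (sv 5) (sv 6)) (csubs (sv 4) (sv 5) (sv 6)))"

text \<open>h (= sv 1) is a boolean-history: h \<notin> h and every x \<in> h (x = sv 3) satisfies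
  x = bpot(x \<inter> h).\<close>
definition bhist :: fm where
  "bhist = And (Neg (mem (sv 1) (sv 1)))
     (All1 (sv 3) (Imp (mem (sv 3) (sv 1))
        (All1 (sv 4) (Iff (mem (sv 4) (sv 3))
           (Ex1 (sv 5) (And (And (mem (sv 5) (sv 3)) (mem (sv 5) (sv 1))) bcond))))))"

text \<open>l (= sv 2) = bpot(h), h = sv 1.\<close>
definition is_bpot :: fm where
  "is_bpot = All1 (sv 4) (Iff (mem (sv 4) (sv 2)) (Ex1 (sv 5) (And (mem (sv 5) (sv 1)) bcond)))"

definition BLT_strat :: fm where
  "BLT_strat = All1 (sv 0) (Imp (Neg (mem (sv 0) (sv 0)))
     (Ex1 (sv 1) (Ex1 (sv 2) (And bhist (And is_bpot (subs (sv 0) (sv 2) (sv 6)))))))"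

definition BLT :: "fm set" where
  "BLT = {BLT_ext, BLT_compl, BLT_sep, BLT_strat}"

definition before :: "var1 \<Rightarrow> var1 \<Rightarrow> fm" where
  "before x s = Ex1 (tv 9) (And (found x (tv 9)) (less (tv 9) s))"

definition BST_order :: fm where
  "BST_order = All1 (tv 0) (All1 (tv 1) (All1 (tv 2)
     (Imp (And (less (tv 0) (tv 1)) (less (tv 1) (tv 2))) (less (tv 0) (tv 2)))))"

definition BST_staging :: fm where
  "BST_staging = All1 (sv 0) (Ex1 (tv 0) (found (sv 0) (tv 0)))"

definition BST_cases :: fm where
  "BST_cases = All1 (sv 0) (Or (low (sv 0)) (high (sv 0)))"

definition BST_prioL :: fm where
  "BST_prioL = All1 (sv 0) (All1 (tv 0) (Imp (And (low (sv 0)) (found (sv 0) (tv 0)))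
     (All1 (sv 1) (Imp (mem (sv 1) (sv 0)) (before (sv 1) (tv 0))))))"

definition BST_prioH :: fm where
  "BST_prioH = All1 (sv 0) (All1 (tv 0) (Imp (And (high (sv 0)) (found (sv 0) (tv 0)))
     (All1 (sv 1) (Imp (Neg (mem (sv 1) (sv 0))) (before (sv 1) (tv 0))))))"

definition BST_specL :: fm where
  "BST_specL = All2 (Fv 0) (All1 (tv 0) (Imp
     (All1 (sv 1) (Imp (RApp (Fv 0) [sv 1]) (before (sv 1) (tv 0))))
     (Ex1 (sv 0) (And (low (sv 0)) (And (found (sv 0) (tv 0))
        (All1 (sv 1) (Iff (RApp (Fv 0) [sv 1]) (mem (sv 1) (sv 0)))))))))"

definition BST_specH :: fm where
  "BST_specH = All2 (Fv 0) (All1 (tv 0) (Imp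
     (All1 (sv 1) (Imp (RApp (Fv 0) [sv 1]) (before (sv 1) (tv 0))))
     (Ex1 (sv 0) (And (high (sv 0)) (And (found (sv 0) (tv 0))
        (All1 (sv 1) (Iff (RApp (Fv 0) [sv 1]) (Neg (mem (sv 1) (sv 0))))))))))"

definition BST :: "fm set" where
  "BST = {BLT_ext, BST_order, BST_staging, BST_cases, BST_prioL, BST_prioH, BST_specL, BST_specH}"

end

theory Submission
  imports Defs "HOL-Library.Countable"
begin

text \<open>
  Both directions are proved semantically, through a completeness theorem for the calculus with
  respect to Henkin models. In a model of BST the stages are well-founded by a Russell-style
  argument, so that low means non-self-membered and high means self-membered; the set of all sets
  found before a stage \<open>s\<close> is then the boolean-level of the history formed by the corresponding sets
  for the stages below \<open>s\<close>, and this yields Stratification. Conversely, a model of BLT becomes a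
  model of BST by reading the boolean-levels as stages, membership as their order, and
  ``\<open>a\<close> or its complement is included in \<open>s\<close>'' as ``\<open>a\<close> is found at \<open>s\<close>''; since the levels are
  definable, comprehension for the two-sorted language reduces to comprehension for membership.
\<close>

section \<open>Henkin semantics\<close>

text \<open>The detour through completeness exists because both implications rest on arguments about
  arbitrary sets and stages that would be unreadable as Hilbert derivations. Only provability is
  claimed, so the models are Henkin models, whose relation domains merely satisfy Comprehension. A
  newly constructed model therefore owes a proof of Comprehension for every formula of the new
  language, including those with Low, High and relation variables over stages. This is why the
  passage from BLT to BST needs a translation of formulas besides a construction of a model. Neither
  theory assumes well-foundedness. BST has only transitivity of <, and does not say that Low and
  High exclude each other; BLT does not say that the members of histories, or the levels, fail to be
  members of themselves. In each theory this has to be extracted from a set of Russell type, formed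
  by Specification or by Separation; the rest then follows by elementary steps.\<close>

record 'a model =
  mdom :: "srt \<Rightarrow> 'a set"
  mrel :: "srt list \<Rightarrow> ('a list \<Rightarrow> bool) set"
  mint :: "prim \<Rightarrow> 'a list \<Rightarrow> bool"

fun sat :: "'a model \<Rightarrow> (var1 \<Rightarrow> 'a) \<Rightarrow> (var2 \<Rightarrow> 'a list \<Rightarrow> bool) \<Rightarrow> fm \<Rightarrow> bool" where
  "sat M e d (Prim p xs) = mint M p (map e xs)"
| "sat M e d (Eq x y) = (e x = e y)"
| "sat M e d (RApp X xs) = d X (map e xs)"
| "sat M e d Bot = False"
| "sat M e d (Imp p q) = (sat M e d p \<longrightarrow> sat M e d q)"
| "sat M e d (All1 x p) = (\<forall>a\<in>mdom M (snd x). sat M (e(x := a)) d p)"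
| "sat M e d (All2 X p) = (\<forall>R\<in>mrel M (snd X). sat M e (d(X := R)) p)"

definition ok :: "'a model \<Rightarrow> (var1 \<Rightarrow> 'a) \<Rightarrow> (var2 \<Rightarrow> 'a list \<Rightarrow> bool) \<Rightarrow> bool" where
  "ok M e d \<longleftrightarrow> (\<forall>x. e x \<in> mdom M (snd x)) \<and> (\<forall>X. d X \<in> mrel M (snd X))"

definition valid :: "'a model \<Rightarrow> fm \<Rightarrow> bool" where
  "valid M p \<longleftrightarrow> (\<forall>e d. ok M e d \<longrightarrow> sat M e d p)"

definition comp_inst :: "var2 \<Rightarrow> var1 list \<Rightarrow> fm \<Rightarrow> fm" where
  "comp_inst X xs p = Ex2 X (Alls xs (Iff (RApp X xs) p))"

text \<open>Domains of sorts and arities outside \<open>L\<close> must be inhabited too: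
  environments are total on all variables, and \<open>ok\<close> has to be satisfiable.\<close>

definition henkin :: "lang \<Rightarrow> 'a model \<Rightarrow> bool" where
  "henkin L M \<longleftrightarrow> (\<forall>s. mdom M s \<noteq> {}) \<and> (\<forall>ss. mrel M ss \<noteq> {}) \<and>
     (\<forall>p X xs. wf L p \<longrightarrow> set (snd X) \<subseteq> fst L \<longrightarrow> map snd xs = snd X \<longrightarrow> distinct xs \<longrightarrow>
        X \<notin> fv2 p \<longrightarrow> valid M (comp_inst X xs p))"

lemma sat_connectives [simp]:
  "sat M e d (Neg p) = (\<not> sat M e d p)"
  "sat M e d (Or p q) = (sat M e d p \<or> sat M e d q)"
  "sat M e d (And p q) = (sat M e d p \<and> sat M e d q)"
  "sat M e d (Iff p q) = (sat M e d p \<longleftrightarrow> sat M e d q)"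
  "sat M e d (Ex1 x p) = (\<exists>a\<in>mdom M (snd x). sat M (e(x := a)) d p)"
  "sat M e d (Ex2 X p) = (\<exists>R\<in>mrel M (snd X). sat M e (d(X := R)) p)"
  by (auto simp: Neg_def Or_def And_def Iff_def Ex1_def Ex2_def)

lemma wf_connectives [simp]:
  "wf L (Neg p) = wf L p"
  "wf L (Or p q) = (wf L p \<and> wf L q)"
  "wf L (And p q) = (wf L p \<and> wf L q)"
  "wf L (Iff p q) = (wf L p \<and> wf L q)"
  "wf L (Ex1 x p) = (snd x \<in> fst L \<and> wf L p)"
  "wf L (Ex2 X p) = (set (snd X) \<subseteq> fst L \<and> wf L p)"
  by (auto simp: Neg_def Or_def And_def Iff_def Ex1_def Ex2_def)

lemma fv1_connectives [simp]:
  "fv1 (Neg p) = fv1 p" "fv1 (Or p q) = fv1 p \<union> fv1 q" "fv1 (And p q) = fv1 p \<union> fv1 q"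
  "fv1 (Iff p q) = fv1 p \<union> fv1 q" "fv1 (Ex1 x p) = fv1 p - {x}" "fv1 (Ex2 X p) = fv1 p"
  by (auto simp: Neg_def Or_def And_def Iff_def Ex1_def Ex2_def)

lemma fv2_connectives [simp]:
  "fv2 (Neg p) = fv2 p" "fv2 (Or p q) = fv2 p \<union> fv2 q" "fv2 (And p q) = fv2 p \<union> fv2 q"
  "fv2 (Iff p q) = fv2 p \<union> fv2 q" "fv2 (Ex1 x p) = fv2 p" "fv2 (Ex2 X p) = fv2 p - {X}"
  by (auto simp: Neg_def Or_def And_def Iff_def Ex1_def Ex2_def)

lemma ok_dom: "ok M e d \<Longrightarrow> e x \<in> mdom M (snd x)"
  unfolding ok_def by blast

lemma ok_rel: "ok M e d \<Longrightarrow> d X \<in> mrel M (snd X)"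
  unfolding ok_def by blast

lemma ok_upd1: "ok M e d \<Longrightarrow> a \<in> mdom M (snd x) \<Longrightarrow> ok M (e(x := a)) d"
  by (auto simp: ok_def)

lemma ok_upd2: "ok M e d \<Longrightarrow> R \<in> mrel M (snd X) \<Longrightarrow> ok M e (d(X := R))"
  by (auto simp: ok_def)

lemma sat_cong:
  assumes "\<And>x. x \<in> fv1 p \<Longrightarrow> e x = e' x" and "\<And>X. X \<in> fv2 p \<Longrightarrow> d X = d' X"
  shows "sat M e d p = sat M e' d' p"
  using assms
proof (induction p arbitrary: e e' d d')
  case (Prim q xs)
  then have "map e xs = map e' xs" by simp
  then show ?case by (metis sat.simps(1))
next
  case (RApp X xs)
  then have "map e xs = map e' xs" by simp
  with RApp show ?case by (metis sat.simps(3) fv2.simps(3) singletonI)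
next
  case (Imp p q)
  have "sat M e d p = sat M e' d' p" by (rule Imp.IH) (use Imp.prems in auto)
  moreover have "sat M e d q = sat M e' d' q" by (rule Imp.IH) (use Imp.prems in auto)
  ultimately show ?case by simp
next
  case (All1 x p)
  have "sat M (e(x := a)) d p = sat M (e'(x := a)) d' p" for a
    by (rule All1.IH) (use All1.prems in auto)
  then show ?case by simp
next
  case (All2 X p)
  have "sat M e (d(X := R)) p = sat M e' (d'(X := R)) p" for R
    by (rule All2.IH) (use All2.prems in auto)
  then show ?case by simp
qed auto

lemma sat_sentence: "sentence p \<Longrightarrow> sat M e d p = sat M e' d' p"
  by (rule sat_cong) (auto simp: sentence_def)

lemma map_rn_id: "x \<notin> set xs \<Longrightarrow> map (rn x y) xs = xs"
  by (rule map_idI) (auto simp: rn_def)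

lemma subst1_id: "x \<notin> fv1 p \<Longrightarrow> subst1 x y p = p"
  by (induction p) (auto simp: map_rn_id rn_def)

lemma subst2_id: "X \<notin> fv2 p \<Longrightarrow> subst2 X Y p = p"
  by (induction p) (auto simp: rn_def)

lemma map_rn_upd: "map (e \<circ> rn x y) xs = map (e(x := e y)) xs"
  by (auto simp: rn_def)

text \<open>If \<open>x\<close> is not free below a binder, substitution is the identity there, and
  the bound variable may even be \<open>y\<close>; otherwise it differs from both \<open>x\<close>
  and \<open>y\<close>, and the two updates commute.\<close>

lemma sat_subst1:
  "substable1 x y p \<Longrightarrow> sat M e d (subst1 x y p) = sat M (e(x := e y)) d p"
proof (induction p arbitrary: e d)
  case (All1 z p)
  show ?case
  proof (cases "x \<in> fv1 (All1 z p)")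
    case False
    then have "sat M (e(x := e y)) d (All1 z p) = sat M e d (All1 z p)"
      by (intro sat_cong) auto
    then show ?thesis using subst1_id[OF False, of y] by metis
  next
    case True
    with All1.prems have z: "z \<noteq> x" "z \<noteq> y" "substable1 x y p" by auto
    have "sat M (e(z := a)) d (subst1 x y p) = sat M (e(x := e y, z := a)) d p" for a
    proof -
      have "(e(z := a))(x := (e(z := a)) y) = e(x := e y, z := a)" using z by (simp add: fun_eq_iff)
      then show ?thesis using All1.IH[OF z(3), of "e(z := a)" d] by metis
    qed
    then show ?thesis using z by (simp del: fun_upd_apply)
  qed
qed (auto simp: map_rn_upd rn_def)

lemma sat_subst2:
  "substable2 X Y p \<Longrightarrow> sat M e d (subst2 X Y p) = sat M e (d(X := d Y)) p"
proof (induction p arbitrary: e d)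
  case (All2 Z p)
  show ?case
  proof (cases "X \<in> fv2 (All2 Z p)")
    case False
    then have "sat M e (d(X := d Y)) (All2 Z p) = sat M e d (All2 Z p)"
      by (intro sat_cong) auto
    then show ?thesis using subst2_id[OF False, of Y] by metis
  next
    case True
    with All2.prems have z: "Z \<noteq> X" "Z \<noteq> Y" "substable2 X Y p" by auto
    have "sat M e (d(Z := R)) (subst2 X Y p) = sat M e (d(X := d Y, Z := R)) p" for R
    proof -
      have "(d(Z := R))(X := (d(Z := R)) Y) = d(X := d Y, Z := R)" using z by (simp add: fun_eq_iff)
      then show ?thesis using All2.IH[OF z(3), of e "d(Z := R)"] by metis
    qed
    then show ?thesis using z by (simp del: fun_upd_apply)
  qed
qed (auto simp: rn_def)

lemma lax_valid:
  assumes "henkin L M" and "p \<in> lax L"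
  shows "valid M p"
  unfolding valid_def
proof (intro allI impI)
  fix e d assume o: "ok M e d"
  from assms(2) show "sat M e d p"
  proof cases
    case (ax_inst1 x p y)
    with ok_dom[OF o, of y] show ?thesis by (simp add: sat_subst1)
  next
    case (ax_inst2 X p Y)
    with ok_rel[OF o, of Y] show ?thesis by (simp add: sat_subst2)
  next
    case (ax_vac1 x p)
    then have "sat M (e(x := a)) d p = sat M e d p" for a by (intro sat_cong) auto
    with ax_vac1 show ?thesis by simp
  next
    case (ax_vac2 X p)
    then have "sat M e (d(X := R)) p = sat M e d p" for R by (intro sat_cong) auto
    with ax_vac2 show ?thesis by simp
  next
    case (ax_leib p x z y)
    then show ?thesis by (simp add: sat_subst1)
  next
    case (ax_comp p X xs)
    with assms(1) o show ?thesis unfolding henkin_def comp_inst_def valid_def by blast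
  qed auto
qed

lemma soundness:
  assumes "henkin L M" and "\<And>q. q \<in> T \<Longrightarrow> valid M q" and "prv L T p"
  shows "valid M p"
  using assms(3)
proof induction
  case (prv_ax p) then show ?case using lax_valid assms(1) by blast
next
  case (prv_hyp p) then show ?case using assms(2) by blast
next
  case (prv_mp p q) then show ?case by (auto simp: valid_def)
next
  case (prv_gen1 p x) then show ?case by (simp add: valid_def ok_upd1)
next
  case (prv_gen2 p X) then show ?case by (simp add: valid_def ok_upd2)
qed

section \<open>The calculus\<close>

lemma wf_subst1: "wf L p \<Longrightarrow> snd y = snd x \<Longrightarrow> wf L (subst1 x y p)"
proof (induction p)
  case (Prim q xs)
  have m: "map (snd \<circ> rn x y) xs = map snd xs" using Prim(2) by (simp add: rn_def)
  show ?case using Prim.prems(1) unfolding subst1.simps wf.simps list.map_comp m .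
next
  case (RApp X xs)
  have m: "map (snd \<circ> rn x y) xs = map snd xs" using RApp(2) by (simp add: rn_def)
  show ?case using RApp.prems(1) unfolding subst1.simps wf.simps list.map_comp m .
qed (auto simp: rn_def)

lemma wf_subst2: "wf L p \<Longrightarrow> snd Y = snd X \<Longrightarrow> wf L (subst2 X Y p)"
  by (induction p) (auto simp: rn_def)

lemma wf_Alls: "wf L (Alls xs p) \<longleftrightarrow> (\<forall>x\<in>set xs. snd x \<in> fst L) \<and> wf L p"
  by (induction xs) (auto simp: Alls_def)

lemma lax_wf: "p \<in> lax L \<Longrightarrow> wf L p"
proof (induction rule: lax.induct)
  case (ax_comp p X xs)
  moreover have "set (snd X) = snd ` set xs" using ax_comp by (metis set_map)
  ultimately show ?case by (auto simp: wf_Alls)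
qed (auto simp: wf_subst1 wf_subst2)

text \<open>The head of the list becomes the innermost antecedent. Discharging a hypothesis is thus
  definitional (\<open>der_Cons\<close>), and the deduction theorem costs nothing.\<close>

fun imps :: "fm list \<Rightarrow> fm \<Rightarrow> fm" where
  "imps [] p = p"
| "imps (q # S) p = imps S (Imp q p)"

lemma wf_imps: "wf L (imps S p) \<longleftrightarrow> (\<forall>q\<in>set S. wf L q) \<and> wf L p"
  by (induction S arbitrary: p) auto

text \<open>Free and bound names of both kinds of variables, with sorts forgotten: a name outside
  this set is fresh in every respect.\<close>

fun nms :: "fm \<Rightarrow> nat set" where
  "nms (Prim p xs) = fst ` set xs"
| "nms (Eq x y) = {fst x, fst y}"
| "nms (RApp X xs) = insert (fst X) (fst ` set xs)"
| "nms Bot = {}"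
| "nms (Imp p q) = nms p \<union> nms q"
| "nms (All1 x p) = insert (fst x) (nms p)"
| "nms (All2 X p) = insert (fst X) (nms p)"

lemma finite_nms: "finite (nms p)"
  by (induction p) auto

lemma fv1_nms: "x \<in> fv1 p \<Longrightarrow> fst x \<in> nms p"
  by (induction p) auto

lemma fv2_nms: "X \<in> fv2 p \<Longrightarrow> fst X \<in> nms p"
  by (induction p) auto

section \<open>Renaming to a fresh name and back\<close>

lemma map_rn_inverse: "y \<notin> set xs \<Longrightarrow> map (rn y x \<circ> rn x y) xs = xs"
  by (rule map_idI) (auto simp: rn_def)

lemma subst1_inverse:
  "fst y \<notin> nms p \<Longrightarrow> subst1 y x (subst1 x y p) = p"
proof (induction p)
  case (Prim q xs)
  then have "y \<notin> set xs" by force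
  then show ?case by (simp add: map_rn_inverse)
next
  case (RApp X xs)
  then have "y \<notin> set xs" by force
  then show ?case by (simp add: map_rn_inverse)
next
  case (All1 z p)
  then have "y \<noteq> z" "y \<notin> fv1 p" using fv1_nms[of y p] by auto
  with All1 show ?case by (auto simp: subst1_id)
qed (auto simp: rn_def)

lemma subst2_inverse:
  "fst Y \<notin> nms p \<Longrightarrow> subst2 Y X (subst2 X Y p) = p"
proof (induction p)
  case (All2 Z p)
  then have "Y \<noteq> Z" "Y \<notin> fv2 p" using fv2_nms[of Y p] by auto
  with All2 show ?case by (auto simp: subst2_id)
qed (auto simp: rn_def)

lemma fv1_subst1: "x \<noteq> y \<Longrightarrow> x \<notin> fv1 (subst1 x y p)"
  by (induction p) (auto simp: rn_def)

lemma fv2_subst2: "X \<noteq> Y \<Longrightarrow> X \<notin> fv2 (subst2 X Y p)"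
  by (induction p) (auto simp: rn_def)

lemma substable1_notin: "x \<notin> fv1 p \<Longrightarrow> substable1 x y p"
  by (induction p) auto

lemma substable2_notin: "X \<notin> fv2 p \<Longrightarrow> substable2 X Y p"
  by (induction p) auto

lemma substable1_inverse:
  "fst y \<notin> nms p \<Longrightarrow> substable1 y x (subst1 x y p)"
proof (induction p)
  case (All1 z p)
  then have "y \<notin> fv1 p" "z \<noteq> y" using fv1_nms[of y p] by auto
  with All1 show ?case by (auto simp: substable1_notin)
qed auto

lemma substable2_inverse:
  "fst Y \<notin> nms p \<Longrightarrow> substable2 Y X (subst2 X Y p)"
proof (induction p)
  case (All2 Z p)
  then have "Y \<notin> fv2 p" "Z \<noteq> Y" using fv2_nms[of Y p] by auto
  with All2 show ?case by (auto simp: substable2_notin)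
qed auto

text \<open>Over sentences the variable conditions of the generalization rules always hold. Further
  hypotheses are kept as antecedents by \<open>der\<close>, and the conditions come back for them in
  \<open>der_gen1\<close> and \<open>der_gen2\<close>.\<close>

locale closed_theory =
  fixes L :: lang and T :: "fm set"
  assumes T_wf: "q \<in> T \<Longrightarrow> wf L q" and T_sentence: "q \<in> T \<Longrightarrow> sentence q"
begin

lemma prv_wf: "prv L T p \<Longrightarrow> wf L p"
  by (induction rule: prv.induct) (auto simp: lax_wf T_wf)

lemma gen1: "prv L T p \<Longrightarrow> snd x \<in> fst L \<Longrightarrow> prv L T (All1 x p)"
  by (rule prv_gen1) (use T_sentence in \<open>auto simp: sentence_def\<close>)

lemma gen2: "prv L T p \<Longrightarrow> set (snd X) \<subseteq> fst L \<Longrightarrow> prv L T (All2 X p)"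
  by (rule prv_gen2) (use T_sentence in \<open>auto simp: sentence_def\<close>)

section \<open>Derivability from a finite list of hypotheses\<close>

definition der :: "fm list \<Rightarrow> fm \<Rightarrow> bool" where
  "der S p \<longleftrightarrow> prv L T (imps S p)"

definition wfs :: "fm list \<Rightarrow> bool" where
  "wfs S \<longleftrightarrow> (\<forall>q\<in>set S. wf L q)"

lemma wfs_Cons [simp]: "wfs (q # S) \<longleftrightarrow> wf L q \<and> wfs S"
  by (simp add: wfs_def)

lemma der_wf: "der S p \<Longrightarrow> wf L p"
  by (auto simp: der_def wf_imps dest!: prv_wf)

lemma der_Cons: "der (q # S) p \<longleftrightarrow> der S (Imp q p)"
  by (simp add: der_def)

lemma der_prv: "prv L T p \<Longrightarrow> wfs S \<Longrightarrow> der S p"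
proof (induction S arbitrary: p)
  case (Cons q S)
  have "prv L T (Imp q p)"
    using Cons.prems prv_mp[OF prv_ax[OF ax_k[of L p q]]] prv_wf by simp
  then show ?case using Cons by (auto simp: der_Cons)
qed (auto simp: der_def)

lemma der_ax: "p \<in> lax L \<Longrightarrow> wfs S \<Longrightarrow> der S p"
  by (simp add: der_prv prv_ax)

lemma der_mp: "der S (Imp p q) \<Longrightarrow> der S p \<Longrightarrow> wfs S \<Longrightarrow> der S q"
proof (induction S arbitrary: p q)
  case Nil then show ?case using prv_mp by (auto simp: der_def)
next
  case (Cons a S)
  have w: "wf L a" "wf L p" "wf L q" "wfs S" using Cons.prems by (auto dest: der_wf)
  have "der S (Imp (Imp a (Imp p q)) (Imp (Imp a p) (Imp a q)))"
    using w by (intro der_ax ax_s)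
  then have "der S (Imp a q)" using Cons w unfolding der_Cons by blast
  then show ?case by (simp add: der_Cons)
qed

lemma der_K: "der S p \<Longrightarrow> wf L q \<Longrightarrow> wfs S \<Longrightarrow> der S (Imp q p)"
  using der_mp der_ax[OF ax_k] der_wf by blast

lemma der_refl: "wf L p \<Longrightarrow> wfs S \<Longrightarrow> der S (Imp p p)"
  using der_mp[OF der_mp[OF der_ax[OF ax_s[of L p "Imp p p" p]] der_ax[OF ax_k[of L p "Imp p p"]]]
      der_ax[OF ax_k[of L p p]]] by simp

lemma der_hyp: "p \<in> set S \<Longrightarrow> wfs S \<Longrightarrow> der S p"
proof (induction S)
  case (Cons q S)
  then show ?case using der_refl der_K by (auto simp: der_Cons wfs_def)
qed simp

lemma der_mono: "der S p \<Longrightarrow> set S \<subseteq> set S' \<Longrightarrow> wfs S' \<Longrightarrow> der S' p"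
proof (induction S arbitrary: p)
  case Nil then show ?case using der_prv by (simp add: der_def)
next
  case (Cons q S)
  then have "der S' (Imp q p)" by (simp add: der_Cons)
  with Cons show ?case using der_mp der_hyp by (meson list.set_intros(1) subsetD)
qed

lemma der_trans: "der S (Imp p q) \<Longrightarrow> der S (Imp q r) \<Longrightarrow> wfs S \<Longrightarrow> der S (Imp p r)"
proof -
  assume a: "der S (Imp p q)" "der S (Imp q r)" "wfs S"
  then have w: "wfs (p # S)" by (auto dest: der_wf)
  have "der (p # S) (Imp q r)" using a w by (auto intro: der_mono)
  then have "der (p # S) r" using a w der_mp by (metis der_Cons)
  then show ?thesis by (simp add: der_Cons)
qed

text \<open>Antecedents are passed one at a time: \<open>ax_dist1\<close> splits the quantified
  implication, and \<open>ax_vac1\<close> puts the quantifier in front of the antecedent, in which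
  \<open>x\<close> is not free.\<close>

lemma der_gen1:
  "der S p \<Longrightarrow> wfs S \<Longrightarrow> snd x \<in> fst L \<Longrightarrow> \<forall>q\<in>set S. x \<notin> fv1 q \<Longrightarrow> der S (All1 x p)"
proof (induction S arbitrary: p)
  case Nil then show ?case by (simp add: der_def gen1)
next
  case (Cons q S)
  have w: "wf L (All1 x (Imp q p))" "wf L (All1 x q)" "wfs S"
    using Cons.prems by (auto dest: der_wf)
  have "der S (All1 x (Imp q p))" using Cons by (auto simp: der_Cons)
  then have "der S (Imp (All1 x q) (All1 x p))" using w der_ax[OF ax_dist1] der_mp by blast
  moreover have "der S (Imp q (All1 x q))" using w Cons.prems by (auto intro!: der_ax ax_vac1)
  ultimately show ?case using w der_trans by (metis der_Cons)
qed

lemma der_gen2: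
  "der S p \<Longrightarrow> wfs S \<Longrightarrow> set (snd X) \<subseteq> fst L \<Longrightarrow> \<forall>q\<in>set S. X \<notin> fv2 q \<Longrightarrow> der S (All2 X p)"
proof (induction S arbitrary: p)
  case Nil then show ?case by (simp add: der_def gen2)
next
  case (Cons q S)
  have w: "wf L (All2 X (Imp q p))" "wf L (All2 X q)" "wfs S"
    using Cons.prems by (auto dest: der_wf)
  have "der S (All2 X (Imp q p))" using Cons by (auto simp: der_Cons)
  then have "der S (Imp (All2 X q) (All2 X p))" using w der_ax[OF ax_dist2] der_mp by blast
  moreover have "der S (Imp q (All2 X q))" using w Cons.prems by (auto intro!: der_ax ax_vac2)
  ultimately show ?case using w der_trans by (metis der_Cons)
qed

lemma der_dn: "der (Neg p # S) Bot \<Longrightarrow> wfs S \<Longrightarrow> der S p"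
proof -
  assume a: "der (Neg p # S) Bot" "wfs S"
  then have "der S (Neg (Neg p))" by (simp add: der_Cons Neg_def)
  moreover have "wf L p" using a by (auto simp: der_Cons Neg_def dest: der_wf)
  ultimately show ?thesis using a der_mp der_ax[OF ax_dn] by blast
qed

text \<open>The calculus has no rule for renaming bound variables. Instantiating the fresh
  \<open>y\<close> by \<open>x\<close> undoes the renaming, and \<open>x\<close> is no longer free
  in the premise, so it can be generalized.\<close>

lemma rebind1:
  assumes "wf L (All1 x q)" and "snd y = snd x" and "fst y \<notin> nms (All1 x q)"
  shows "prv L T (Imp (All1 y (subst1 x y q)) (All1 x q))"
proof -
  let ?q = "subst1 x y q"
  have w: "wf L (All1 y ?q)" "snd x \<in> fst L" using assms by (auto simp: wf_subst1)
  have ne: "x \<noteq> y" using assms by auto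
  have "Imp (All1 y ?q) (subst1 y x ?q) \<in> lax L"
    using assms w by (intro ax_inst1) (auto simp: substable1_inverse)
  then have "der [All1 y ?q] q"
    using assms by (auto simp: der_def subst1_inverse intro: prv_ax)
  then have "der [All1 y ?q] (All1 x q)"
    by (rule der_gen1) (use w ne in \<open>auto simp: wfs_def fv1_subst1\<close>)
  then show ?thesis by (simp add: der_def)
qed

lemma rebind2:
  assumes "wf L (All2 X q)" and "snd Y = snd X" and "fst Y \<notin> nms (All2 X q)"
  shows "prv L T (Imp (All2 Y (subst2 X Y q)) (All2 X q))"
proof -
  let ?q = "subst2 X Y q"
  have w: "wf L (All2 Y ?q)" "set (snd X) \<subseteq> fst L" using assms by (auto simp: wf_subst2)
  have ne: "X \<noteq> Y" using assms by auto
  have "Imp (All2 Y ?q) (subst2 Y X ?q) \<in> lax L"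
    using assms w by (intro ax_inst2) (auto simp: substable2_inverse)
  then have "der [All2 Y ?q] q"
    using assms by (auto simp: der_def subst2_inverse intro: prv_ax)
  then have "der [All2 Y ?q] (All2 X q)"
    by (rule der_gen2) (use w ne in \<open>auto simp: wfs_def fv2_subst2\<close>)
  then show ?thesis by (simp add: der_def)
qed

section \<open>Consistency and Henkin witnesses\<close>

definition con :: "fm list \<Rightarrow> bool" where
  "con S \<longleftrightarrow> wfs S \<and> \<not> der S Bot"

lemma con_Neg:
  assumes "con S" and "wf L p" and "\<not> con (p # S)"
  shows "con (Neg p # S)"
proof -
  have "der S (Imp p Bot)" using assms by (auto simp: con_def der_Cons)
  then show ?thesis using assms der_dn[of p S] der_mp by (auto simp: con_def)
qed

text \<open>Otherwise \<open>S\<close> proves the instance at the fresh \<open>y\<close>, hence, by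
  generalization and \<open>rebind1\<close>, also \<open>All1 x q\<close>, whose negation belongs to
  \<open>S\<close>.\<close>

lemma con_wit1:
  assumes "con S" and "Neg (All1 x q) \<in> set S" and "snd y = snd x"
    and "\<forall>p\<in>set S. fst y \<notin> nms p"
  shows "con (Neg (subst1 x y q) # S)"
proof (rule ccontr)
  assume "\<not> ?thesis"
  have wS: "wfs S" using assms by (simp add: con_def)
  then have w: "wf L (All1 x q)" using assms(2) by (metis wfs_def wf_connectives(1))
  with \<open>\<not> ?thesis\<close> have "der (Neg (subst1 x y q) # S) Bot"
    using wS assms by (auto simp: con_def wf_subst1)
  then have "der S (subst1 x y q)" using der_dn wS by blast
  then have "der S (All1 y (subst1 x y q))"
    by (rule der_gen1) (use assms w wS fv1_nms[of y] in auto)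
  moreover have "fst y \<notin> nms (All1 x q)" using assms(2,4) by (fastforce simp: Neg_def)
  ultimately have "der S (All1 x q)"
    using rebind1 w assms(3) der_prv der_mp wS by blast
  then have "der S Bot" using der_hyp[OF assms(2) wS] der_mp wS unfolding Neg_def by blast
  then show False using assms by (simp add: con_def)
qed

lemma con_wit2:
  assumes "con S" and "Neg (All2 X q) \<in> set S" and "snd Y = snd X"
    and "\<forall>p\<in>set S. fst Y \<notin> nms p"
  shows "con (Neg (subst2 X Y q) # S)"
proof (rule ccontr)
  assume "\<not> ?thesis"
  have wS: "wfs S" using assms by (simp add: con_def)
  then have w: "wf L (All2 X q)" using assms(2) by (metis wfs_def wf_connectives(1))
  with \<open>\<not> ?thesis\<close> have "der (Neg (subst2 X Y q) # S) Bot"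
    using wS assms by (auto simp: con_def wf_subst2)
  then have "der S (subst2 X Y q)" using der_dn wS by blast
  then have "der S (All2 Y (subst2 X Y q))"
    by (rule der_gen2) (use assms w wS fv2_nms[of Y] in auto)
  moreover have "fst Y \<notin> nms (All2 X q)" using assms(2,4) by (fastforce simp: Neg_def)
  ultimately have "der S (All2 X q)"
    using rebind2 w assms(3) der_prv der_mp wS by blast
  then have "der S Bot" using der_hyp[OF assms(2) wS] der_mp wS unfolding Neg_def by blast
  then show False using assms by (simp add: con_def)
qed

text \<open>A negated universal formula receives its witness in the same step, so one enumeration of
  the formulas serves both maximality and witnesses.\<close>

definition decides :: "nat set \<Rightarrow> fm set \<Rightarrow> fm \<Rightarrow> bool" where
  "decides P G p \<longleftrightarrow> (wf L p \<longrightarrow> p \<in> G \<or> Neg p \<in> G \<and>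
     (\<forall>x q. p = All1 x q \<longrightarrow>
        (\<exists>y. fst y \<in> P \<and> snd y = snd x \<and> Neg (subst1 x y q) \<in> G)) \<and>
     (\<forall>X q. p = All2 X q \<longrightarrow>
        (\<exists>Y. fst Y \<in> P \<and> snd Y = snd X \<and> Neg (subst2 X Y q) \<in> G)))"

lemma con_extend:
  assumes "infinite P" and "con S"
  shows "\<exists>S'. con S' \<and> set S \<subseteq> set S' \<and> decides P (set S') p"
proof (cases "wf L p \<and> \<not> con (p # S)")
  case False
  then have "con (p # S) \<or> \<not> wf L p" by blast
  then show ?thesis
  proof
    assume "con (p # S)"
    then show ?thesis by (intro exI[of _ "p # S"]) (auto simp: decides_def)
  next
    assume "\<not> wf L p"
    then show ?thesis using assms(2) by (intro exI[of _ S]) (auto simp: decides_def)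
  qed
next
  case True
  let ?S = "Neg p # S"
  have c: "con ?S" using con_Neg assms True by blast
  have "finite (\<Union>q\<in>set ?S. nms q)" using finite_nms by blast
  then obtain n where n: "n \<in> P" "n \<notin> (\<Union>q\<in>set ?S. nms q)"
    using assms(1) by (meson finite_subset subsetI)
  show ?thesis
  proof (cases "(\<exists>x q. p = All1 x q) \<or> (\<exists>X q. p = All2 X q)")
    case False
    with c show ?thesis by (intro exI[of _ ?S]) (auto simp: decides_def)
  next
    case True
    then show ?thesis
    proof
      assume "\<exists>x q. p = All1 x q"
      then obtain x q where p: "p = All1 x q" by blast
      have "con (Neg (subst1 x (n, snd x) q) # ?S)"
        by (rule con_wit1) (use c n p in auto)
      then show ?thesis using p n
        by (intro exI[of _ "Neg (subst1 x (n, snd x) q) # ?S"]) (auto simp: decides_def)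
    next
      assume "\<exists>X q. p = All2 X q"
      then obtain X q where p: "p = All2 X q" by blast
      have "con (Neg (subst2 X (n, snd X) q) # ?S)"
        by (rule con_wit2) (use c n p in auto)
      then show ?thesis using p n
        by (intro exI[of _ "Neg (subst2 X (n, snd X) q) # ?S"]) (auto simp: decides_def)
    qed
  qed
qed

end

section \<open>Completeness\<close>

declare split_paired_All [simp del] split_paired_Ex [simp del]

instance srt :: countable by countable_datatype
instance prim :: countable by countable_datatype
instance fm :: countable by countable_datatype

text \<open>The variables with index in \<open>P\<close> serve as Henkin constants: they name the elements and relations
  of the term model. The truth lemma is stated for formulas that bind none of them, which keeps all
  substitutions free of capture.\<close>

locale henkin_set =
  fixes L :: lang and G :: "fm set" and P :: "nat set"
  assumes G_wf: "p \<in> G \<Longrightarrow> wf L p"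
    and G_ax: "p \<in> lax L \<Longrightarrow> p \<in> G"
    and G_Bot: "Bot \<notin> G"
    and G_Imp: "wf L p \<Longrightarrow> wf L q \<Longrightarrow> Imp p q \<in> G \<longleftrightarrow> (p \<in> G \<longrightarrow> q \<in> G)"
    and G_wit1: "wf L (All1 x p) \<Longrightarrow> All1 x p \<notin> G \<Longrightarrow>
      \<exists>y. fst y \<in> P \<and> snd y = snd x \<and> subst1 x y p \<notin> G"
    and G_wit2: "wf L (All2 X p) \<Longrightarrow> All2 X p \<notin> G \<Longrightarrow>
      \<exists>Y. fst Y \<in> P \<and> snd Y = snd X \<and> subst2 X Y p \<notin> G"
    and P_nonempty: "P \<noteq> {}"
    and P_odd: "n \<in> P \<Longrightarrow> odd n"

lemma (in closed_theory) lindenbaum: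
  assumes "infinite P" and "\<And>n. n \<in> P \<Longrightarrow> odd n" and "con [p]"
  shows "\<exists>G. henkin_set L G P \<and> p \<in> G \<and> T \<subseteq> G"
proof -
  obtain S where S0: "set (S 0) = {p}" and Sc: "\<And>n. con (S n)"
    and Ss: "\<And>n. set (S n) \<subseteq> set (S (Suc n)) \<and> decides P (set (S (Suc n))) (from_nat n)"
  proof -
    have "\<exists>S. \<forall>n. (con (S n) \<and> (n = 0 \<longrightarrow> set (S n) = {p})) \<and>
        (set (S n) \<subseteq> set (S (Suc n)) \<and> decides P (set (S (Suc n))) (from_nat n))"
    proof (rule dependent_nat_choice)
      show "\<exists>S. con S \<and> (0 = (0::nat) \<longrightarrow> set S = {p})"
        using assms(3) by (intro exI[of _ "[p]"]) auto
    next
      fix S :: "fm list" and n :: nat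
      assume "con S \<and> (n = 0 \<longrightarrow> set S = {p})"
      then show "\<exists>S'. (con S' \<and> (Suc n = 0 \<longrightarrow> set S' = {p})) \<and>
          (set S \<subseteq> set S' \<and> decides P (set S') (from_nat n))"
        using con_extend[OF assms(1)] by auto
    qed
    then show ?thesis using that by blast
  qed
  have Sm: "set (S m) \<subseteq> set (S n)" if "m \<le> n" for m n
    using that by (induction rule: dec_induct) (use Ss in auto)
  define G where "G = (\<Union>n. set (S n))"
  \<comment> \<open>\<open>decides\<close> survives enlarging the set, so the stage at which
    \<open>q\<close> is enumerated settles it for the union.\<close>
  have dec: "decides P G q" for q
  proof -
    have d: "decides P (set (S (Suc (to_nat q)))) q" using Ss[of "to_nat q"] by simp
    have "set (S (Suc (to_nat q))) \<subseteq> G" by (auto simp: G_def)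
    then show ?thesis using d unfolding decides_def by blast
  qed
  have wfs: "wfs (S n)" for n using Sc by (simp add: con_def)
  have wfG: "wf L q" if "q \<in> G" for q using that wfs by (auto simp: G_def wfs_def)
  \<comment> \<open>The stages increase, so finitely many members of \<open>G\<close> occur together
    in one of them, and consistency passes from the stages to \<open>G\<close>.\<close>
  have fin: "\<exists>n. set A \<subseteq> set (S n)" if "set A \<subseteq> G" for A
    using that
  proof (induction A)
    case (Cons a A)
    then obtain m n where "a \<in> set (S m)" "set A \<subseteq> set (S n)" by (auto simp: G_def)
    then have "set (a # A) \<subseteq> set (S (max m n))" using Sm[of m "max m n"] Sm[of n "max m n"] by auto
    then show ?case by blast
  qed simp
  have cons: "\<not> der A Bot" if "set A \<subseteq> G" for A
    using fin[OF that] der_mono Sc con_def by blast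
  have derG: "q \<in> G" if "set A \<subseteq> G" "der A q" for A q
  proof (rule ccontr)
    assume "q \<notin> G"
    then have n: "Neg q \<in> G" using dec[of q] der_wf[OF that(2)] by (auto simp: decides_def)
    let ?A = "Neg q # A"
    have w: "wfs ?A" using n that wfG der_wf[OF that(2)] by (auto simp: wfs_def)
    have "der ?A q" using der_mono[OF that(2), of ?A] w by auto
    moreover have "der ?A (Imp q Bot)" using der_hyp[of "Neg q" ?A] w by (simp add: Neg_def)
    ultimately have "der ?A Bot" using der_mp w by blast
    then show False using cons[of ?A] n that by auto
  qed
  have neg: "q \<in> G \<longleftrightarrow> Neg q \<notin> G" if "wf L q" for q
  proof
    assume "q \<in> G"
    show "Neg q \<notin> G"
    proof
      assume "Neg q \<in> G"
      have w: "wfs [q, Neg q]" using \<open>q \<in> G\<close> \<open>Neg q \<in> G\<close> wfG by (auto simp: wfs_def)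
      have "der [q, Neg q] (Imp q Bot)" using der_hyp[of "Neg q" "[q, Neg q]"] w by (simp add: Neg_def)
      moreover have "der [q, Neg q] q" using der_hyp w by simp
      ultimately have "der [q, Neg q] Bot" using der_mp w by blast
      then show False using cons[of "[q, Neg q]"] \<open>q \<in> G\<close> \<open>Neg q \<in> G\<close> by auto
    qed
  next
    assume "Neg q \<notin> G" then show "q \<in> G" using dec[of q] that by (auto simp: decides_def)
  qed
  have prvG: "q \<in> G" if "prv L T q" for q
    using derG[of "[]" q] that by (simp add: der_def)
  have "henkin_set L G P"
  proof
    show "wf L q" if "q \<in> G" for q using wfG that .
    show "q \<in> G" if "q \<in> lax L" for q using prvG prv_ax that by blast
    show "Bot \<notin> G" using cons[of "[Bot]"] der_hyp[of Bot "[Bot]"] by (auto simp: wfs_def)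
    show "Imp q r \<in> G \<longleftrightarrow> (q \<in> G \<longrightarrow> r \<in> G)" if w: "wf L q" "wf L r" for q r
    proof
      assume i: "Imp q r \<in> G"
      show "q \<in> G \<longrightarrow> r \<in> G"
      proof
        assume "q \<in> G"
        have "wfs [Imp q r, q]" using w by (auto simp: wfs_def)
        then have "der [Imp q r, q] r" using der_mp der_hyp by (meson list.set_intros)
        then show "r \<in> G" using derG[of "[Imp q r, q]"] i \<open>q \<in> G\<close> by auto
      qed
    next
      assume a: "q \<in> G \<longrightarrow> r \<in> G"
      show "Imp q r \<in> G"
      proof (cases "r \<in> G")
        case True
        have "der [r] (Imp q r)" using der_K[of "[r]" r q] der_hyp[of r "[r]"] w by (auto simp: wfs_def)
        then show ?thesis using derG[of "[r]"] True by auto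
      next
        case False
        then have n: "Neg q \<in> G" using a neg w by blast
        \<comment> \<open>Ex falso by double negation: with \<open>Neg r\<close> in front,
          \<open>der_dn\<close> turns the contradiction between \<open>q\<close> and
          \<open>Neg q\<close> into a derivation of \<open>r\<close>.\<close>
        let ?A = "[Neg r, q, Neg q]"
        have wA: "wfs ?A" using w by (auto simp: wfs_def)
        have "der ?A (Imp q Bot)" using der_hyp[of "Neg q" ?A] wA by (simp add: Neg_def)
        then have "der ?A Bot" using der_mp der_hyp wA by (meson list.set_intros)
        then have "der [q, Neg q] r" using der_dn wA by simp
        then have "der [Neg q] (Imp q r)" by (simp add: der_Cons)
        then show ?thesis using derG[of "[Neg q]"] n by auto
      qed
    qed
    show "\<exists>y. fst y \<in> P \<and> snd y = snd x \<and> subst1 x y q \<notin> G"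
      if w: "wf L (All1 x q)" and nG: "All1 x q \<notin> G" for x q
    proof -
      obtain y where y: "fst y \<in> P" "snd y = snd x" "Neg (subst1 x y q) \<in> G"
        using dec[of "All1 x q"] w nG by (auto simp: decides_def)
      then show ?thesis using neg[of "subst1 x y q"] w wf_subst1 by auto
    qed
    show "\<exists>Y. fst Y \<in> P \<and> snd Y = snd X \<and> subst2 X Y q \<notin> G"
      if w: "wf L (All2 X q)" and nG: "All2 X q \<notin> G" for X q
    proof -
      obtain Y where y: "fst Y \<in> P" "snd Y = snd X" "Neg (subst2 X Y q) \<in> G"
        using dec[of "All2 X q"] w nG by (auto simp: decides_def)
      then show ?thesis using neg[of "subst2 X Y q"] w wf_subst2 by auto
    qed
    show "P \<noteq> {}" using assms(1) by auto
    show "odd n" if "n \<in> P" for n using assms(2) that .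
  qed
  moreover have "T \<subseteq> G" using prvG prv_hyp by blast
  moreover have "p \<in> G" using S0 by (auto simp: G_def)
  ultimately show ?thesis by blast
qed

section \<open>Simultaneous substitution of parameters\<close>

fun bnd :: "fm \<Rightarrow> nat set" where
  "bnd (Imp p q) = bnd p \<union> bnd q"
| "bnd (All1 x p) = insert (fst x) (bnd p)"
| "bnd (All2 X p) = insert (fst X) (bnd p)"
| "bnd _ = {}"

text \<open>Nothing is renamed. This is right for replacing variables by parameters in formulas that
  bind no parameter.\<close>

fun sub :: "(var1 \<Rightarrow> var1) \<Rightarrow> (var2 \<Rightarrow> var2) \<Rightarrow> fm \<Rightarrow> fm" where
  "sub r t (Prim p xs) = Prim p (map r xs)"
| "sub r t (Eq x y) = Eq (r x) (r y)"
| "sub r t (RApp X xs) = RApp (t X) (map r xs)"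
| "sub r t Bot = Bot"
| "sub r t (Imp p q) = Imp (sub r t p) (sub r t q)"
| "sub r t (All1 x p) = All1 x (sub (r(x := x)) t p)"
| "sub r t (All2 X p) = All2 X (sub r (t(X := X)) p)"

lemma bnd_sub [simp]: "bnd (sub r t p) = bnd p"
  by (induction p arbitrary: r t) auto

lemma substable1_bnd: "fst y \<notin> bnd p \<Longrightarrow> substable1 x y p"
  by (induction p) auto

lemma substable2_bnd: "fst Y \<notin> bnd p \<Longrightarrow> substable2 X Y p"
  by (induction p) auto

lemma bnd_nms: "bnd p \<subseteq> nms p"
  by (induction p) auto

lemma wf_sub:
  "wf L p \<Longrightarrow> (\<And>x. snd (r x) = snd x) \<Longrightarrow> (\<And>X. snd (t X) = snd X) \<Longrightarrow> wf L (sub r t p)"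
proof (induction p arbitrary: r t)
  case (Prim q xs)
  have m: "map (snd \<circ> r) xs = map snd xs" using Prim(2) by simp
  show ?case using Prim.prems(1) unfolding sub.simps wf.simps list.map_comp m .
next
  case (RApp X xs)
  have m: "map (snd \<circ> r) xs = map snd xs" using RApp(2) by simp
  show ?case using RApp.prems(1) unfolding sub.simps wf.simps list.map_comp m RApp.prems(3) .
next
  case (All1 x p)
  have "wf L (sub (r(x := x)) t p)" by (rule All1.IH) (use All1.prems in auto)
  then show ?case using All1.prems by simp
next
  case (All2 X p)
  have "wf L (sub r (t(X := X)) p)" by (rule All2.IH) (use All2.prems in auto)
  then show ?case using All2.prems by simp
qed auto

lemma sub_cong:
  assumes "\<And>x. x \<in> fv1 p \<Longrightarrow> r x = r' x" and "\<And>X. X \<in> fv2 p \<Longrightarrow> t X = t' X"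
  shows "sub r t p = sub r' t' p"
  using assms
proof (induction p arbitrary: r t r' t')
  case (Imp p q)
  have "sub r t p = sub r' t' p" by (rule Imp.IH) (use Imp.prems in auto)
  moreover have "sub r t q = sub r' t' q" by (rule Imp.IH) (use Imp.prems in auto)
  ultimately show ?case by simp
next
  case (All1 x p)
  have "sub (r(x := x)) t p = sub (r'(x := x)) t' p" by (rule All1.IH) (use All1.prems in auto)
  then show ?case by simp
next
  case (All2 X p)
  have "sub r (t(X := X)) p = sub r' (t'(X := X)) p" by (rule All2.IH) (use All2.prems in auto)
  then show ?case by simp
qed auto

lemma sub_ident: "sub (\<lambda>x. x) (\<lambda>X. X) p = p"
proof (induction p)
  case (All1 x p)
  have "(\<lambda>x. x)(x := x) = (\<lambda>x. x)" by auto
  then show ?case using All1 by simp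
next
  case (All2 X p)
  have "(\<lambda>x. x)(X := X) = (\<lambda>x. x)" by auto
  then show ?case using All2 by simp
qed auto

lemma sub_sentence: "sentence p \<Longrightarrow> sub r t p = p"
  using sub_cong[of p r "\<lambda>x. x" t "\<lambda>X. X"] sub_ident by (simp add: sentence_def)

text \<open>No other free variable is sent to \<open>x\<close>, so the later replacement hits
  exactly the occurrences that were \<open>x\<close> from the start.\<close>

lemma subst1_sub:
  "x \<notin> r ` (fv1 p - {x}) \<Longrightarrow> subst1 x y (sub (r(x := x)) t p) = sub (r(x := y)) t p"
proof (induction p arbitrary: r t)
  case (All1 z p)
  show ?case
  proof (cases "z = x")
    case False
    have "x \<notin> (r(z := z)) ` (fv1 p - {x})" using All1.prems False by auto
    then have "subst1 x y (sub ((r(z := z))(x := x)) t p) = sub ((r(z := z))(x := y)) t p"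
      by (rule All1.IH)
    then show ?thesis using False fun_upd_twist[of x z r] by (simp del: fun_upd_apply)
  qed (simp del: fun_upd_apply)
next
  case (Imp p q)
  have "x \<notin> r ` (fv1 p - {x})" "x \<notin> r ` (fv1 q - {x})" using Imp.prems by auto
  then show ?case using Imp.IH[of r] by (simp del: fun_upd_apply)
qed (auto simp: rn_def)

lemma subst2_sub:
  "X \<notin> t ` (fv2 p - {X}) \<Longrightarrow> subst2 X Y (sub r (t(X := X)) p) = sub r (t(X := Y)) p"
proof (induction p arbitrary: r t)
  case (All2 Z p)
  show ?case
  proof (cases "Z = X")
    case False
    have "X \<notin> (t(Z := Z)) ` (fv2 p - {X})" using All2.prems False by auto
    then have "subst2 X Y (sub r ((t(Z := Z))(X := X)) p) = sub r ((t(Z := Z))(X := Y)) p"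
      by (rule All2.IH)
    then show ?thesis using False fun_upd_twist[of X Z t] by (simp del: fun_upd_apply)
  qed (simp del: fun_upd_apply)
next
  case (Imp p q)
  have "X \<notin> t ` (fv2 p - {X})" "X \<notin> t ` (fv2 q - {X})" using Imp.prems by auto
  then show ?case using Imp.IH[where t = t] by (simp del: fun_upd_apply)
qed (auto simp: rn_def)

lemma fv2_sub: "fv2 (sub r t p) \<subseteq> t ` fv2 p"
proof (induction p arbitrary: r t)
  case (All2 X p)
  have "fv2 (sub r (t(X := X)) p) \<subseteq> (t(X := X)) ` fv2 p" by (rule All2.IH)
  then show ?case by auto
qed force+

lemma sub_connectives [simp]:
  "sub r t (Neg p) = Neg (sub r t p)"
  "sub r t (And p q) = And (sub r t p) (sub r t q)"
  "sub r t (Iff p q) = Iff (sub r t p) (sub r t q)"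
  "sub r t (Ex2 X p) = Ex2 X (sub r (t(X := X)) p)"
  by (auto simp: Neg_def And_def Iff_def Ex2_def)

lemma sub_Alls: "sub r t (Alls xs p) = Alls xs (sub (\<lambda>x. if x \<in> set xs then x else r x) t p)"
proof (induction xs arbitrary: r)
  case (Cons x xs)
  have "(\<lambda>z. if z \<in> set xs then z else (r(x := x)) z) = (\<lambda>z. if z \<in> set (x # xs) then z else r z)"
    by auto
  then show ?case using Cons[of "r(x := x)"] by (simp add: Alls_def del: fun_upd_apply)
qed (simp add: Alls_def)

text \<open>Parameters (indices in \<open>P\<close>) are odd, so a formula with doubled indices binds no parameter.\<close>

definition dbl :: "nat \<times> 'b \<Rightarrow> nat \<times> 'b" where "dbl x = (2 * fst x, snd x)"
definition hlf :: "nat \<times> 'b \<Rightarrow> nat \<times> 'b" where "hlf x = (fst x div 2, snd x)"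

fun ren :: "fm \<Rightarrow> fm" where
  "ren (Prim p xs) = Prim p (map dbl xs)"
| "ren (Eq x y) = Eq (dbl x) (dbl y)"
| "ren (RApp X xs) = RApp (dbl X) (map dbl xs)"
| "ren Bot = Bot"
| "ren (Imp p q) = Imp (ren p) (ren q)"
| "ren (All1 x p) = All1 (dbl x) (ren p)"
| "ren (All2 X p) = All2 (dbl X) (ren p)"

lemma snd_dbl [simp]: "snd (dbl x) = snd x" by (simp add: dbl_def)
lemma snd_hlf [simp]: "snd (hlf x) = snd x" by (simp add: hlf_def)
lemma hlf_dbl [simp]: "hlf (dbl x) = x" by (simp add: hlf_def dbl_def)
lemma dbl_eq_iff [simp]: "dbl x = dbl y \<longleftrightarrow> x = y" by (metis hlf_dbl)
lemma even_dbl [simp]: "even (fst (dbl x))" by (simp add: dbl_def)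

lemma ren_connectives [simp]:
  "ren (Neg p) = Neg (ren p)"
  "ren (And p q) = And (ren p) (ren q)"
  "ren (Iff p q) = Iff (ren p) (ren q)"
  "ren (Ex2 X p) = Ex2 (dbl X) (ren p)"
  by (auto simp: Neg_def And_def Iff_def Ex2_def)

lemma ren_Alls: "ren (Alls xs p) = Alls (map dbl xs) (ren p)"
  by (induction xs) (auto simp: Alls_def)

lemma ren_comp_inst: "ren (comp_inst X xs p) = comp_inst (dbl X) (map dbl xs) (ren p)"
  by (simp add: comp_inst_def ren_Alls)

lemma wf_ren: "wf L p \<Longrightarrow> wf L (ren p)"
  by (induction p) (auto simp: comp_def)

lemma fv2_ren: "fv2 (ren p) = dbl ` fv2 p"
  by (induction p) auto

lemma bnd_ren: "n \<in> bnd (ren p) \<Longrightarrow> even n"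
  by (induction p) auto

lemma sat_ren: "sat M e d (ren p) = sat M (e \<circ> dbl) (d \<circ> dbl) p"
proof (induction p arbitrary: e d)
  case (All1 x p)
  have "(e(dbl x := a)) \<circ> dbl = (e \<circ> dbl)(x := a)" for a by (auto simp: fun_eq_iff)
  then show ?case using All1 by (simp del: fun_upd_apply comp_apply)
next
  case (All2 X p)
  have "(d(dbl X := R)) \<circ> dbl = (d \<circ> dbl)(X := R)" for R by (auto simp: fun_eq_iff)
  then show ?case using All2 by (simp del: fun_upd_apply comp_apply)
qed auto

lemma ok_exists:
  assumes "henkin L M"
  shows "\<exists>e d. ok M e d"
proof -
  have "(SOME a. a \<in> mdom M s) \<in> mdom M s" "(SOME R. R \<in> mrel M ss) \<in> mrel M ss" for s ss
    using assms by (auto simp: henkin_def some_in_eq)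
  then show ?thesis
    by (intro exI[of _ "\<lambda>x. SOME a. a \<in> mdom M (snd x)"]
        exI[of _ "\<lambda>X. SOME R. R \<in> mrel M (snd X)"]) (simp add: ok_def)
qed

section \<open>The term model\<close>

context henkin_set
begin

definition cls :: "var1 \<Rightarrow> var1 set" where
  "cls x = {y. Eq x y \<in> G}"

definition relof :: "var2 \<Rightarrow> var1 set list \<Rightarrow> bool" where
  "relof X as \<longleftrightarrow> (\<exists>xs. map cls xs = as \<and> RApp X xs \<in> G)"

text \<open>No equation of a sort outside \<open>L\<close> is in \<open>G\<close>, so such a sort
  has one element, the empty class; likewise an arity outside \<open>L\<close> has only the empty
  relation. All domains are inhabited because \<open>P\<close> is nonempty.\<close>

definition termmodel :: "var1 set model" where
  "termmodel = \<lparr> mdom = (\<lambda>s. cls ` {y. fst y \<in> P \<and> snd y = s}),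
     mrel = (\<lambda>ss. relof ` {Y. fst Y \<in> P \<and> snd Y = ss}),
     mint = (\<lambda>p as. \<exists>xs. map cls xs = as \<and> Prim p xs \<in> G) \<rparr>"

lemma G_mp: "Imp p q \<in> G \<Longrightarrow> p \<in> G \<Longrightarrow> q \<in> G"
  using G_Imp G_wf wf.simps(5) by blast

lemma Eq_refl: "snd x \<in> fst L \<Longrightarrow> Eq x x \<in> G"
  by (simp add: G_ax ax_refl)

lemma Eq_sort: "Eq x y \<in> G \<Longrightarrow> snd x = snd y \<and> snd x \<in> fst L"
  using G_wf by fastforce

lemma leibniz:
  assumes "Eq x y \<in> G" and "wf L p" and "snd z = snd x"
    and "substable1 z x p" and "substable1 z y p" and "subst1 z x p \<in> G"
  shows "subst1 z y p \<in> G"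
proof -
  have "Imp (Eq x y) (Imp (subst1 z x p) (subst1 z y p)) \<in> lax L"
    using assms Eq_sort[OF assms(1)] by (intro ax_leib) auto
  then show ?thesis using G_ax G_mp assms by blast
qed

lemma fresh_var: "\<exists>z::var1. snd z = s \<and> z \<notin> set xs"
proof -
  have "infinite (range (\<lambda>n::nat. (n, s)))"
    by (subst finite_image_iff) (auto intro: inj_onI)
  then obtain z where "z \<in> range (\<lambda>n::nat. (n, s))" "z \<notin> set xs"
    by (meson List.finite_set finite_subset subsetI)
  then show ?thesis by (intro exI[of _ z]) auto
qed

lemma Eq_sym: assumes "Eq x y \<in> G" shows "Eq y x \<in> G"
proof -
  obtain z :: var1 where z: "snd z = snd x" "z \<notin> set [x]" using fresh_var by blast
  have "subst1 z y (Eq z x) \<in> G"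
    by (rule leibniz[OF assms]) (use z Eq_sort[OF assms] Eq_refl[of x] in \<open>auto simp: rn_def\<close>)
  then show ?thesis using z by (simp add: rn_def)
qed

lemma Eq_trans: assumes "Eq x y \<in> G" "Eq y w \<in> G" shows "Eq x w \<in> G"
proof -
  obtain z :: var1 where z: "snd z = snd y" "z \<notin> set [x]" using fresh_var by blast
  have "subst1 z w (Eq x z) \<in> G"
    by (rule leibniz[OF assms(2)])
      (use z assms Eq_sort[OF assms(1)] Eq_sort[OF assms(2)] in \<open>auto simp: rn_def\<close>)
  then show ?thesis using z by (simp add: rn_def)
qed

lemma cls_eq: "snd x \<in> fst L \<Longrightarrow> cls x = cls y \<longleftrightarrow> Eq x y \<in> G"
  unfolding cls_def using Eq_refl Eq_sym Eq_trans by blast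

text \<open>Leibniz's law replaces one argument at a time: \<open>us\<close> holds the arguments
  already replaced, and the fresh \<open>z\<close> marks the current place.\<close>

lemma atom_cong:
  assumes A: "A = Prim q \<or> A = RApp X"
  shows "list_all2 (\<lambda>x y. Eq x y \<in> G) xs ys \<Longrightarrow> A (us @ xs) \<in> G \<Longrightarrow> A (us @ ys) \<in> G"
proof (induction xs ys arbitrary: us rule: list_all2_induct)
  case (Cons x xs y ys)
  obtain z :: var1 where z: "snd z = snd x" "z \<notin> set (us @ xs)" using fresh_var by blast
  have m: "map (rn z w) us = us" "map (rn z w) xs = xs" for w using z by (auto simp: map_rn_id)
  have s: "subst1 z w (A (us @ z # xs)) = A (us @ w # xs)" for w
    using A m[of w] by (auto simp: rn_def)
  have "wf L (A (us @ z # xs))" using G_wf[OF Cons.prems] A z(1) by auto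
  moreover have "substable1 z w (A (us @ z # xs))" for w using A by auto
  ultimately have "A (us @ y # xs) \<in> G"
    using leibniz[OF Cons.hyps(1), of "A (us @ z # xs)" z] s z Cons.prems by auto
  then show ?case using Cons.IH[of "us @ [y]"] by simp
qed simp

text \<open>Whether an atom is in \<open>G\<close> depends only on the classes of its arguments;
  hence the existential choice of representatives in \<open>relof\<close> and \<open>mint\<close> is
  harmless.\<close>

lemma atom_iff:
  assumes A: "A = Prim q \<or> A = RApp X" and s: "snd ` set xs \<subseteq> fst L"
  shows "(\<exists>ys. map cls ys = map cls xs \<and> A ys \<in> G) \<longleftrightarrow> A xs \<in> G"
proof
  assume "\<exists>ys. map cls ys = map cls xs \<and> A ys \<in> G"
  then obtain ys where ys: "map cls ys = map cls xs" "A ys \<in> G" by blast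
  have "list_all2 (\<lambda>x y. cls x = cls y) xs ys"
    using ys(1) by (metis list.rel_map list_all2_refl list_all2_eq list.rel_eq)
  then have "list_all2 (\<lambda>y x. Eq y x \<in> G) ys xs"
    using s
  proof (induction xs ys rule: list_all2_induct)
    case (Cons x xs y ys)
    then show ?case using cls_eq Eq_sym by auto
  qed simp
  then show "A xs \<in> G" using atom_cong[OF A, of ys xs "[]"] ys by simp
qed blast

lemma All1_iff:
  assumes "wf L (All1 x p)" and "bnd p \<inter> P = {}"
  shows "All1 x p \<in> G \<longleftrightarrow> (\<forall>y. fst y \<in> P \<and> snd y = snd x \<longrightarrow> subst1 x y p \<in> G)"
proof
  assume a: "All1 x p \<in> G"
  show "\<forall>y. fst y \<in> P \<and> snd y = snd x \<longrightarrow> subst1 x y p \<in> G"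
  proof (intro allI impI)
    fix y :: var1 assume y: "fst y \<in> P \<and> snd y = snd x"
    then have "Imp (All1 x p) (subst1 x y p) \<in> lax L"
      using assms by (intro ax_inst1) (auto intro!: substable1_bnd)
    then show "subst1 x y p \<in> G" using G_ax G_mp a by blast
  qed
qed (use G_wit1 assms(1) in blast)

lemma All2_iff:
  assumes "wf L (All2 X p)" and "bnd p \<inter> P = {}"
  shows "All2 X p \<in> G \<longleftrightarrow> (\<forall>Y. fst Y \<in> P \<and> snd Y = snd X \<longrightarrow> subst2 X Y p \<in> G)"
proof
  assume a: "All2 X p \<in> G"
  show "\<forall>Y. fst Y \<in> P \<and> snd Y = snd X \<longrightarrow> subst2 X Y p \<in> G"
  proof (intro allI impI)
    fix Y :: var2 assume y: "fst Y \<in> P \<and> snd Y = snd X"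
    then have "Imp (All2 X p) (subst2 X Y p) \<in> lax L"
      using assms by (intro ax_inst2) (auto intro!: substable2_bnd)
    then show "subst2 X Y p \<in> G" using G_ax G_mp a by blast
  qed
qed (use G_wit2 assms(1) in blast)

definition inP :: "(nat \<times> 'b \<Rightarrow> nat \<times> 'b) \<Rightarrow> bool" where
  "inP r \<longleftrightarrow> (\<forall>x. fst (r x) \<in> P \<and> snd (r x) = snd x)"

text \<open>At a quantifier the elements to be tested are the classes of parameters, and updating
  the environment at \<open>x\<close> by \<open>cls y\<close> amounts to substituting
  \<open>y\<close> for \<open>x\<close>. The bound \<open>x\<close> is not a parameter, so
  \<open>r\<close> sends nothing to it and \<open>subst1_sub\<close> applies.\<close>

lemma truth:
  "wf L p \<Longrightarrow> bnd p \<inter> P = {} \<Longrightarrow> inP r \<Longrightarrow> inP t \<Longrightarrow>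
    sat termmodel (cls \<circ> r) (relof \<circ> t) p \<longleftrightarrow> sub r t p \<in> G"
proof (induction p arbitrary: r t)
  case (Prim q xs)
  have "map snd (map r xs) = map snd xs" using Prim.prems(3) by (simp add: inP_def)
  then have "snd ` set (map r xs) \<subseteq> fst L" using Prim.prems(1) by (metis set_map wf.simps(1))
  then show ?case using atom_iff[of "Prim q" q undefined "map r xs"] by (simp add: termmodel_def comp_def)
next
  case (RApp X xs)
  have "map snd (map r xs) = map snd xs" using RApp.prems(3) by (simp add: inP_def)
  then have "snd ` set (map r xs) \<subseteq> fst L" using RApp.prems(1) by (metis set_map wf.simps(3))
  then show ?case using atom_iff[of "RApp (t X)" undefined "t X" "map r xs"] by (simp add: relof_def comp_def)
next
  case (Eq x y)
  have "snd (r x) \<in> fst L" using Eq by (metis inP_def wf.simps(2))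
  then show ?case by (simp add: cls_eq)
next
  case Bot then show ?case using G_Bot by simp
next
  case (Imp p q)
  have "wf L (sub r t p)" "wf L (sub r t q)" using Imp.prems by (auto intro!: wf_sub simp: inP_def)
  moreover have "sat termmodel (cls \<circ> r) (relof \<circ> t) p \<longleftrightarrow> sub r t p \<in> G"
    by (rule Imp.IH) (use Imp.prems in auto)
  moreover have "sat termmodel (cls \<circ> r) (relof \<circ> t) q \<longleftrightarrow> sub r t q \<in> G"
    by (rule Imp.IH) (use Imp.prems in auto)
  ultimately show ?case using G_Imp unfolding sat.simps sub.simps by blast
next
  case (All1 x p)
  have w: "wf L (All1 x (sub (r(x := x)) t p))"
    using wf_sub[OF All1.prems(1), of r t] All1.prems by (simp add: inP_def)
  have x: "fst x \<notin> P" using All1.prems by auto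
  have "sat termmodel ((cls \<circ> r)(x := cls y)) (relof \<circ> t) p
      \<longleftrightarrow> subst1 x y (sub (r(x := x)) t p) \<in> G" if y: "fst y \<in> P" "snd y = snd x" for y
  proof -
    have "(cls \<circ> r)(x := cls y) = cls \<circ> r(x := y)" by (auto simp: fun_eq_iff)
    moreover have "sat termmodel (cls \<circ> r(x := y)) (relof \<circ> t) p \<longleftrightarrow> sub (r(x := y)) t p \<in> G"
      by (rule All1.IH) (use All1.prems y in \<open>auto simp: inP_def\<close>)
    moreover have "x \<notin> r ` (fv1 p - {x})" using x All1.prems(3) unfolding inP_def by blast
    ultimately show ?thesis using subst1_sub by metis
  qed
  moreover have "sat termmodel (cls \<circ> r) (relof \<circ> t) (All1 x p) \<longleftrightarrow>
      (\<forall>y. fst y \<in> P \<and> snd y = snd x \<longrightarrow> sat termmodel ((cls \<circ> r)(x := cls y)) (relof \<circ> t) p)"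
    by (auto simp: termmodel_def simp del: fun_upd_apply)
  moreover have "bnd (sub (r(x := x)) t p) \<inter> P = {}" using All1.prems by auto
  ultimately show ?case using All1_iff[OF w] unfolding sub.simps by blast
next
  case (All2 X p)
  have w: "wf L (All2 X (sub r (t(X := X)) p))"
    using wf_sub[OF All2.prems(1), of r t] All2.prems by (simp add: inP_def)
  have x: "fst X \<notin> P" using All2.prems by auto
  have "sat termmodel (cls \<circ> r) ((relof \<circ> t)(X := relof Y)) p
      \<longleftrightarrow> subst2 X Y (sub r (t(X := X)) p) \<in> G" if y: "fst Y \<in> P" "snd Y = snd X" for Y
  proof -
    have "(relof \<circ> t)(X := relof Y) = relof \<circ> t(X := Y)" by (auto simp: fun_eq_iff)
    moreover have "sat termmodel (cls \<circ> r) (relof \<circ> t(X := Y)) p \<longleftrightarrow> sub r (t(X := Y)) p \<in> G"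
      by (rule All2.IH) (use All2.prems y in \<open>auto simp: inP_def\<close>)
    moreover have "X \<notin> t ` (fv2 p - {X})" using x All2.prems(4) unfolding inP_def by blast
    ultimately show ?thesis using subst2_sub by metis
  qed
  moreover have "sat termmodel (cls \<circ> r) (relof \<circ> t) (All2 X p) \<longleftrightarrow>
      (\<forall>Y. fst Y \<in> P \<and> snd Y = snd X \<longrightarrow> sat termmodel (cls \<circ> r) ((relof \<circ> t)(X := relof Y)) p)"
    by (auto simp: termmodel_def simp del: fun_upd_apply)
  moreover have "bnd (sub r (t(X := X)) p) \<inter> P = {}" using All2.prems by auto
  ultimately show ?case using All2_iff[OF w] unfolding sub.simps by blast
qed

lemma ok_representatives:
  assumes "ok termmodel e d"
  shows "\<exists>r t. inP r \<and> inP t \<and> e = cls \<circ> r \<and> d = relof \<circ> t"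
proof -
  have "\<forall>x. \<exists>y. fst y \<in> P \<and> snd y = snd x \<and> e x = cls y"
  proof
    fix x show "\<exists>y. fst y \<in> P \<and> snd y = snd x \<and> e x = cls y"
      using ok_dom[OF assms, of x] by (auto simp: termmodel_def)
  qed
  then obtain r where "\<forall>x. fst (r x) \<in> P \<and> snd (r x) = snd x \<and> e x = cls (r x)" by metis
  moreover have "\<forall>X. \<exists>Y. fst Y \<in> P \<and> snd Y = snd X \<and> d X = relof Y"
  proof
    fix X show "\<exists>Y. fst Y \<in> P \<and> snd Y = snd X \<and> d X = relof Y"
      using ok_rel[OF assms, of X] by (auto simp: termmodel_def)
  qed
  then obtain t where "\<forall>X. fst (t X) \<in> P \<and> snd (t X) = snd X \<and> d X = relof (t X)" by metis
  ultimately show ?thesis by (intro exI[of _ r] exI[of _ t]) (auto simp: inP_def fun_eq_iff)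
qed

text \<open>A comprehension formula may bind parameters, which blocks \<open>truth\<close>. Its copy
  with doubled indices does not, and the environment is read through halved indices to match.
  Substituting parameters into the copy gives another comprehension instance, which is in
  \<open>G\<close> as an axiom.\<close>

lemma henkin_termmodel: "henkin L termmodel"
proof -
  have comp: "valid termmodel (comp_inst X xs p)"
    if p: "wf L p" "set (snd X) \<subseteq> fst L" "map snd xs = snd X" "distinct xs" "X \<notin> fv2 p" for p X xs
    unfolding valid_def
  proof (intro allI impI)
    fix e d assume "ok termmodel e d"
    then obtain r t where rt: "inP r" "inP t" "e = cls \<circ> r" "d = relof \<circ> t"
      using ok_representatives by blast
    have i: "inP (r \<circ> hlf)" "inP (t \<circ> hlf)" using rt by (auto simp: inP_def)
    let ?c = "comp_inst X xs p" and ?X = "dbl X" and ?xs = "map dbl xs"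
    let ?p = "sub (\<lambda>x. if x \<in> set ?xs then x else (r \<circ> hlf) x) ((t \<circ> hlf)(?X := ?X)) (ren p)"
    have "snd ` set xs \<subseteq> fst L" using p by (metis set_map)
    then have "wf L ?c" using p by (auto simp: comp_inst_def wf_Alls)
    then have w: "wf L (ren ?c)" by (rule wf_ren)
    have b: "bnd (ren ?c) \<inter> P = {}" using bnd_ren P_odd by blast
    have e: "(cls \<circ> (r \<circ> hlf)) \<circ> dbl = e" "(relof \<circ> (t \<circ> hlf)) \<circ> dbl = d"
      using rt by (auto simp: fun_eq_iff)
    have m: "map (\<lambda>x. if x \<in> set ?xs then x else (r \<circ> hlf) x) ?xs = ?xs"
      by (rule map_idI) simp
    have s: "sub (r \<circ> hlf) (t \<circ> hlf) (ren ?c) = comp_inst ?X ?xs ?p"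
      unfolding ren_comp_inst unfolding comp_inst_def
      by (simp only: sub_connectives sub_Alls sub.simps m fun_upd_same)
    have "comp_inst ?X ?xs ?p \<in> lax L"
      unfolding comp_inst_def
    proof (rule ax_comp)
      show "wf L ?p" using i p by (intro wf_sub wf_ren) (auto simp: inP_def)
      show "set (snd ?X) \<subseteq> fst L" "distinct ?xs" "map snd ?xs = snd ?X"
        using p by (auto simp: distinct_map inj_on_def comp_def)
      \<comment> \<open>Parameters are odd and \<open>?X\<close> has an even name, so the
        substitution cannot make \<open>?X\<close> free in \<open>?p\<close>.\<close>
      have "fst ?X \<notin> P" using P_odd even_dbl by blast
      moreover have "?X \<notin> fv2 (ren p)" using p by (auto simp: fv2_ren)
      moreover have "fst ((t \<circ> hlf) Y) \<in> P" for Y using i(2) unfolding inP_def by blast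
      ultimately have "?X \<notin> ((t \<circ> hlf)(?X := ?X)) ` fv2 (ren p)" by (auto simp del: comp_apply)
      then show "?X \<notin> fv2 ?p" using subsetD[OF fv2_sub] by blast
    qed
    then have "sub (r \<circ> hlf) (t \<circ> hlf) (ren ?c) \<in> G" using s G_ax by simp
    then have "sat termmodel (cls \<circ> (r \<circ> hlf)) (relof \<circ> (t \<circ> hlf)) (ren ?c)"
      using truth[OF w b i] by blast
    then show "sat termmodel e d ?c" unfolding sat_ren e .
  qed
  obtain n where "n \<in> P" using P_nonempty by blast
  then have "cls (n, s) \<in> mdom termmodel s" "relof (n, ss) \<in> mrel termmodel ss" for s ss
    by (auto simp: termmodel_def)
  then have "mdom termmodel s \<noteq> {}" "mrel termmodel ss \<noteq> {}" for s ss by blast+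
  then show ?thesis unfolding henkin_def using comp by blast
qed

end

text \<open>Testing models over \<open>var1 set\<close> suffices, because the countermodel is a term
  model.\<close>

theorem completeness:
  assumes "finite T" and "\<And>q. q \<in> T \<Longrightarrow> wf L q \<and> sentence q" and "wf L p" and "sentence p"
    and M: "\<And>M :: var1 set model. henkin L M \<Longrightarrow> (\<And>q. q \<in> T \<Longrightarrow> valid M q) \<Longrightarrow> valid M p"
  shows "prv L T p"
proof (rule ccontr)
  assume np: "\<not> prv L T p"
  interpret closed_theory L T using assms(2) by unfold_locales auto
  have "finite (\<Union>q\<in>insert p T. nms q)" using assms(1) finite_nms by blast
  then obtain N where N: "\<forall>n\<in>(\<Union>q\<in>insert p T. nms q). n < N"
    using finite_nat_set_iff_bounded by blast
  \<comment> \<open>Starting at \<open>N\<close>, parameters avoid every name in \<open>T\<close>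
    and \<open>p\<close>. These formulas bind no parameter, so \<open>truth\<close> applies to them
    without renaming.\<close>
  define P where "P = {n. odd n \<and> n \<ge> N}"
  have "infinite P"
  proof
    assume "finite P"
    then obtain m where "\<forall>n\<in>P. n < m" using finite_nat_set_iff_bounded by blast
    moreover have "2 * (m + N) + 1 \<in> P" by (simp add: P_def)
    ultimately show False by fastforce
  qed
  moreover have "\<And>n. n \<in> P \<Longrightarrow> odd n" by (simp add: P_def)
  moreover have "con [Neg p]"
  proof -
    have "\<not> der [Neg p] Bot" using np der_dn[of p "[]"] by (auto simp: wfs_def der_def)
    then show ?thesis using assms(3) by (simp add: con_def wfs_def)
  qed
  ultimately obtain G where G: "henkin_set L G P" "Neg p \<in> G" "T \<subseteq> G"
    using lindenbaum[of P "Neg p"] by blast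
  interpret henkin_set L G P by (rule G)
  have t: "sat termmodel e d q \<longleftrightarrow> q \<in> G"
    if q: "wf L q" "sentence q" "nms q \<subseteq> (\<Union>q\<in>insert p T. nms q)" and o: "ok termmodel e d" for q e d
  proof -
    have b: "bnd q \<inter> P = {}"
    proof (rule ccontr)
      assume "bnd q \<inter> P \<noteq> {}"
      then obtain n where "n \<in> bnd q" "n \<ge> N" by (auto simp: P_def)
      moreover from this have "n < N" using bnd_nms q(3) N by blast
      ultimately show False by simp
    qed
    obtain r t where rt: "inP r" "inP t" and ed: "e = cls \<circ> r" "d = relof \<circ> t"
      using ok_representatives[OF o] by blast
    show ?thesis using truth[OF q(1) b rt] unfolding ed sub_sentence[OF q(2)] .
  qed
  have "valid termmodel q" if q: "q \<in> T" for q
  proof -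
    have "nms q \<subseteq> (\<Union>q\<in>insert p T. nms q)" using q by blast
    then show ?thesis unfolding valid_def using t[of q] q assms(2) G(3) by blast
  qed
  then have "valid termmodel p" using M henkin_termmodel by blast
  moreover obtain e d where ed: "ok termmodel e d"
    using ok_exists[OF henkin_termmodel] by blast
  moreover have "nms p \<subseteq> (\<Union>q\<in>insert p T. nms q)" by blast
  ultimately have "p \<in> G" using t[OF assms(3,4) _ ed] unfolding valid_def by blast
  then show False using G(2) G_mp[of p Bot] G_Bot by (simp add: Neg_def)
qed

section \<open>Boolean levels\<close>

definition bounded :: "'a set \<Rightarrow> ('a \<Rightarrow> 'a \<Rightarrow> bool) \<Rightarrow> 'a \<Rightarrow> 'a \<Rightarrow> bool" where
  "bounded U E x c \<longleftrightarrow> (\<forall>w\<in>U. E w x \<longrightarrow> E w c) \<or> (\<forall>w\<in>U. \<not> E w x \<longrightarrow> E w c)"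

definition bpot_of :: "'a set \<Rightarrow> ('a \<Rightarrow> 'a \<Rightarrow> bool) \<Rightarrow> 'a \<Rightarrow> 'a \<Rightarrow> bool" where
  "bpot_of U E h l \<longleftrightarrow> (\<forall>y\<in>U. E y l \<longleftrightarrow> (\<exists>c\<in>U. E c h \<and> \<not> E c c \<and> bounded U E y c))"

definition history :: "'a set \<Rightarrow> ('a \<Rightarrow> 'a \<Rightarrow> bool) \<Rightarrow> 'a \<Rightarrow> bool" where
  "history U E h \<longleftrightarrow> \<not> E h h \<and> (\<forall>x\<in>U. E x h \<longrightarrow>
     (\<forall>y\<in>U. E y x \<longleftrightarrow> (\<exists>c\<in>U. (E c x \<and> E c h) \<and> \<not> E c c \<and> bounded U E y c)))"

definition level :: "'a set \<Rightarrow> ('a \<Rightarrow> 'a \<Rightarrow> bool) \<Rightarrow> 'a \<Rightarrow> bool" where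
  "level U E l \<longleftrightarrow> (\<exists>h\<in>U. history U E h \<and> bpot_of U E h l)"

text \<open>The boolean analogue of a transitive set: a member is included, or its complement
  is.\<close>

definition btrans :: "'a set \<Rightarrow> ('a \<Rightarrow> 'a \<Rightarrow> bool) \<Rightarrow> 'a \<Rightarrow> bool" where
  "btrans U E y \<longleftrightarrow> (\<forall>z\<in>U. E z y \<longrightarrow> bounded U E z y)"

text \<open>Comprehension enters only through the instances \<open>comp_mem\<close> and
  \<open>comp_russell\<close>; \<open>D\<close> is otherwise an arbitrary family of
  predicates.\<close>

locale blt =
  fixes U :: "'a set" and E :: "'a \<Rightarrow> 'a \<Rightarrow> bool" and D :: "('a \<Rightarrow> bool) set"
  assumes ext: "\<lbrakk>a \<in> U; b \<in> U; \<And>x. x \<in> U \<Longrightarrow> E x a \<longleftrightarrow> E x b\<rbrakk> \<Longrightarrow> a = b"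
    and compl: "a \<in> U \<Longrightarrow> \<exists>c\<in>U. (\<forall>x\<in>U. E x c \<longleftrightarrow> \<not> E x a) \<and> (\<not> E a a \<longleftrightarrow> E c c)"
    and sep: "\<lbrakk>F \<in> D; a \<in> U; \<not> E a a\<rbrakk> \<Longrightarrow> \<exists>b\<in>U. \<not> E b b \<and> (\<forall>x\<in>U. E x b \<longleftrightarrow> F x \<and> E x a)"
    and strat: "\<lbrakk>a \<in> U; \<not> E a a\<rbrakk> \<Longrightarrow>
      \<exists>h\<in>U. \<exists>l\<in>U. history U E h \<and> bpot_of U E h l \<and> (\<forall>w\<in>U. E w a \<longrightarrow> E w l)"
    and comp_mem: "a \<in> U \<Longrightarrow> \<exists>F\<in>D. \<forall>x\<in>U. F x \<longleftrightarrow> E x a"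
    and comp_russell: "h \<in> U \<Longrightarrow> \<exists>F\<in>D. \<forall>x\<in>U. F x \<longleftrightarrow>
      \<not> E x x \<and> (\<forall>y\<in>U. E y h \<and> \<not> E y y \<and> \<not> btrans U E y \<longrightarrow> E x y)"
begin

abbreviation "bd \<equiv> bounded U E"

lemma inter: "\<lbrakk>a \<in> U; \<not> E a a; x \<in> U\<rbrakk> \<Longrightarrow> \<exists>k\<in>U. \<not> E k k \<and> (\<forall>w\<in>U. E w k \<longleftrightarrow> E w x \<and> E w a)"
  using comp_mem[of x] sep[of _ a] by (metis (no_types, lifting))

text \<open>Separation carves \<open>x\<close> out of \<open>c\<close>, and the set it returns is
  not a member of itself; by extensionality this set is \<open>x\<close>.\<close>

lemma subset_low:
  assumes "x \<in> U" "c \<in> U" "\<not> E c c" "\<forall>w\<in>U. E w x \<longrightarrow> E w c"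
  shows "\<not> E x x"
proof -
  obtain k where "k \<in> U" "\<not> E k k" "\<forall>w\<in>U. E w k \<longleftrightarrow> E w x \<and> E w c"
    using inter assms by blast
  moreover from this have "k = x" using assms by (intro ext) auto
  ultimately show ?thesis by blast
qed

lemma cosubset_high:
  assumes "x \<in> U" "c \<in> U" "\<not> E c c" "\<forall>w\<in>U. \<not> E w x \<longrightarrow> E w c"
  shows "E x x"
proof -
  obtain k where "k \<in> U" "\<forall>w\<in>U. E w k \<longleftrightarrow> \<not> E w x" "\<not> E x x \<longleftrightarrow> E k k"
    using compl assms by blast
  then show ?thesis using subset_low[of k c] assms by blast
qed

text \<open>The other disjunct of \<open>bounded\<close> is excluded: a set whose complement lies in
  a \<open>c\<close> with \<open>c\<close> not in \<open>c\<close> is a member of itself.\<close>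

lemma bounded_low: "\<lbrakk>bd x c; x \<in> U; c \<in> U; \<not> E c c; \<not> E x x; w \<in> U; E w x\<rbrakk> \<Longrightarrow> E w c"
  unfolding bounded_def using cosubset_high by blast

lemma bounded_high: "\<lbrakk>bd x c; x \<in> U; c \<in> U; \<not> E c c; E x x; w \<in> U; \<not> E w x\<rbrakk> \<Longrightarrow> E w c"
  unfolding bounded_def using subset_low by blast

lemma bounded_mono: "bd x c \<Longrightarrow> (\<And>w. w \<in> U \<Longrightarrow> E w c \<Longrightarrow> E w d) \<Longrightarrow> bd x d"
  unfolding bounded_def by blast

lemma bounded_refl: "bd c c"
  unfolding bounded_def by blast

section \<open>Members of boolean-histories\<close>

lemma history_low: "history U E h \<Longrightarrow> \<not> E h h"
  by (simp add: history_def)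

lemma history_mem: "\<lbrakk>history U E h; x \<in> U; E x h; y \<in> U\<rbrakk> \<Longrightarrow>
    E y x \<longleftrightarrow> (\<exists>c\<in>U. (E c x \<and> E c h) \<and> \<not> E c c \<and> bd y c)"
  unfolding history_def by blast

text \<open>A Russell-style well-foundedness argument: the set of non-self-membered elements common to all
  counterexamples would belong to every counterexample that has a counterexample as a member.\<close>

lemma history_low_member_btrans:
  assumes h: "h \<in> U" "history U E h" and a: "a \<in> U" "E a h" "\<not> E a a"
  shows "btrans U E a"
proof (rule ccontr)
  assume na: "\<not> btrans U E a"
  obtain F where F: "F \<in> D" "\<forall>x\<in>U. F x \<longleftrightarrow>
      \<not> E x x \<and> (\<forall>y\<in>U. E y h \<and> \<not> E y y \<and> \<not> btrans U E y \<longrightarrow> E x y)"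
    using comp_russell h by blast
  obtain d where d: "d \<in> U" "\<not> E d d" "\<forall>x\<in>U. E x d \<longleftrightarrow> F x \<and> E x a"
    using sep F(1) a by blast
  \<comment> \<open>As \<open>d\<close> is not in \<open>d\<close>, one of the two conditions for
    membership fails for it. If \<open>F d\<close> held, \<open>d\<close> would lie in the
    counterexample \<open>a\<close> as well; so \<open>F d\<close> fails, and some counterexample
    \<open>y\<close> omits \<open>d\<close>.\<close>
  then have "\<not> (F d \<and> E d a)" by blast
  then obtain y where y: "y \<in> U" "E y h" "\<not> E y y" "\<not> btrans U E y" "\<not> E d y"
    using F(2) d a na by blast
  have "bd z y" if z: "z \<in> U" "E z y" for z
  proof -
    obtain c where c: "c \<in> U" "E c y" "E c h" "\<not> E c c" "bd z c"
      using history_mem[OF h(2) y(1,2) z(1)] z by blast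
    have "btrans U E c"
    proof (rule ccontr)
      assume "\<not> btrans U E c"
      \<comment> \<open>All members of \<open>d\<close> lie in every counterexample, hence in
        \<open>c\<close>. Then \<open>c\<close> witnesses that \<open>d\<close> belongs to
        \<open>y\<close>, which is false.\<close>
      then have "bd d c" using d F(2) c unfolding bounded_def by blast
      then show False using history_mem[OF h(2) y(1,2) d(1)] c y by blast
    qed
    \<comment> \<open>Each member of \<open>c\<close> is bounded by \<open>c\<close> itself, so the
      history condition puts it into \<open>y\<close>. Thus \<open>c\<close> is included in
      \<open>y\<close>, and a bound by \<open>c\<close> becomes a bound by \<open>y\<close>.\<close>
    then have "E w y" if "w \<in> U" "E w c" for w
      using history_mem[OF h(2) y(1,2) that(1)] c that unfolding btrans_def by blast
    then show ?thesis using c bounded_mono by blast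
  qed
  then show False using y by (simp add: btrans_def)
qed

text \<open>Take \<open>h\<close> for \<open>y\<close>: since \<open>h\<close> is not in
  \<open>h\<close>, the resulting \<open>c\<close> includes \<open>h\<close>, and being a member of
  \<open>h\<close> it contains itself.\<close>

lemma not_universal:
  assumes h: "h \<in> U" "history U E h" and "\<forall>y\<in>U. \<exists>c\<in>U. E c h \<and> \<not> E c c \<and> bd y c"
  shows False
  using assms bounded_low history_low by blast

text \<open>If \<open>x\<close> is in \<open>x\<close>, the \<open>c\<close> that bounds it includes
  the complement of \<open>x\<close>. Anything outside \<open>x\<close> is then in \<open>c\<close>,
  hence bounded by \<open>c\<close>, hence in \<open>x\<close> after all. So \<open>x\<close> is
  universal, against \<open>not_universal\<close>.\<close>

lemma history_member_low:
  assumes h: "h \<in> U" "history U E h" and x: "x \<in> U" "E x h"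
  shows "\<not> E x x"
proof
  assume "E x x"
  then obtain c where c: "c \<in> U" "E c x" "E c h" "\<not> E c c" "bd x c"
    using history_mem h x by blast
  have "E y x" if y: "y \<in> U" for y
  proof (rule ccontr)
    assume "\<not> E y x"
    then have "E y c" using bounded_high c x \<open>E x x\<close> y by blast
    then have "bd y c" using history_low_member_btrans h c y unfolding btrans_def by blast
    then show False using history_mem[OF h(2) x y] c \<open>\<not> E y x\<close> by blast
  qed
  then show False using not_universal[OF h] history_mem[OF h(2) x] by blast
qed

lemma history_member_btrans:
  "\<lbrakk>h \<in> U; history U E h; x \<in> U; E x h\<rbrakk> \<Longrightarrow> btrans U E x"
  using history_low_member_btrans history_member_low by blast

text \<open>The intersection of \<open>a\<close> and \<open>h\<close> is the required history: its
  members \<open>x\<close> are included in \<open>a\<close>, so intersecting \<open>x\<close> with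
  it is the same as intersecting \<open>x\<close> with \<open>h\<close>.\<close>

lemma history_member_level:
  assumes h: "h \<in> U" "history U E h" and a: "a \<in> U" "E a h"
  shows "level U E a"
proof -
  obtain k where k: "k \<in> U" "\<not> E k k" "\<forall>w\<in>U. E w k \<longleftrightarrow> E w a \<and> E w h"
    using inter[of h a] h a history_low by blast
  have sub: "E w a" if x: "x \<in> U" "E x a" "E x h" and w: "w \<in> U" "E w x" for x w
    using history_member_btrans[OF h a] bounded_low[of x a w] history_member_low[OF h] x a w
    unfolding btrans_def by blast
  have "history U E k"
    unfolding history_def
  proof (intro conjI ballI impI)
    fix x y assume x: "x \<in> U" "E x k" and y: "y \<in> U"
    then have "E x a" "E x h" using k by auto
    have "(E c x \<and> E c k) \<longleftrightarrow> (E c x \<and> E c h)" if "c \<in> U" for c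
      using that k sub[OF x(1) \<open>E x a\<close> \<open>E x h\<close>] by blast
    then show "E y x \<longleftrightarrow> (\<exists>c\<in>U. (E c x \<and> E c k) \<and> \<not> E c c \<and> bd y c)"
      using history_mem[OF h(2) x(1) \<open>E x h\<close> y] by blast
  qed (use k in blast)
  moreover have "bpot_of U E k a"
    unfolding bpot_of_def using history_mem[OF h(2) a] k by blast
  ultimately show ?thesis using k(1) unfolding level_def by blast
qed

section \<open>Boolean-levels in the role of stages\<close>

lemma level_member:
  assumes "s \<in> U" "level U E s" "x \<in> U" "E x s"
  shows "\<exists>r\<in>U. level U E r \<and> bd x r \<and> E r s"
proof -
  obtain h where h: "h \<in> U" "history U E h" "bpot_of U E h s" using assms level_def by metis
  then obtain c where c: "c \<in> U" "E c h" "\<not> E c c" "bd x c"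
    using assms unfolding bpot_of_def by blast
  then have "E c s" using h bounded_refl unfolding bpot_of_def by blast
  then show ?thesis using c history_member_level h by blast
qed

text \<open>Members of \<open>h\<close> are included in \<open>s\<close>, so bounds by them become
  bounds by \<open>s\<close>. If \<open>s\<close> were in \<open>s\<close>, some \<open>c\<close> in
  \<open>h\<close> would include the complement of \<open>s\<close>; as \<open>c\<close> is included
  in \<open>s\<close>, the level would be universal.\<close>

lemma level_low_btrans:
  assumes "s \<in> U" "level U E s"
  shows "\<not> E s s" "btrans U E s"
proof -
  obtain h where h: "h \<in> U" "history U E h" "bpot_of U E h s" using assms level_def by metis
  have sub: "E w s" if "c \<in> U" "E c h" "w \<in> U" "E w c" for c w
    using that h history_member_btrans[of h c] history_member_low[of h c]
    unfolding bpot_of_def btrans_def by blast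
  have s: "\<exists>c\<in>U. E c h \<and> \<not> E c c \<and> bd y c" if "y \<in> U" "E y s" for y
    using that h unfolding bpot_of_def by blast
  show "btrans U E s"
    unfolding btrans_def using s sub bounded_mono by blast
  show "\<not> E s s"
  proof
    assume "E s s"
    then obtain c where c: "c \<in> U" "E c h" "\<not> E c c" "bd s c" using s assms by blast
    have "E y s" if "y \<in> U" for y
      using that bounded_high[OF c(4)] sub c assms \<open>E s s\<close> by blast
    then show False using not_universal[OF h(1,2)] s by blast
  qed
qed

text \<open>Some \<open>k\<close> in the history bounds \<open>c\<close>. As \<open>c\<close> is not
  in \<open>c\<close>, it is included in \<open>k\<close>, which therefore bounds \<open>x\<close>
  too.\<close>

lemma level_bpotent:
  assumes s: "s \<in> U" "level U E s" and c: "c \<in> U" "E c s" "\<not> E c c" and x: "x \<in> U" "bd x c"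
  shows "E x s"
proof -
  obtain h where h: "h \<in> U" "history U E h" "bpot_of U E h s" using assms level_def by metis
  then obtain k where k: "k \<in> U" "E k h" "\<not> E k k" "bd c k"
    using c unfolding bpot_of_def by blast
  then have "bd x k" using bounded_mono[OF x(2)] bounded_low c by blast
  then show ?thesis using h k x unfolding bpot_of_def by blast
qed

lemma level_trans:
  "\<lbrakk>r \<in> U; s \<in> U; t \<in> U; level U E s; level U E t; E r s; E s t\<rbrakk> \<Longrightarrow> E r t"
  using level_low_btrans bounded_low unfolding btrans_def by blast

text \<open>Stratification covers only sets that are not members of themselves; for the others it is
  applied to the complement.\<close>

lemma level_staging:
  assumes a: "a \<in> U"
  shows "\<exists>s\<in>U. level U E s \<and> bd a s"
proof (cases "E a a")
  case False
  then show ?thesis using strat[OF a] unfolding level_def bounded_def by blast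
next
  case True
  then obtain c where c: "c \<in> U" "\<forall>x\<in>U. E x c \<longleftrightarrow> \<not> E x a" "\<not> E c c" using compl a by blast
  then obtain h l where "h \<in> U" "l \<in> U" "history U E h" "bpot_of U E h l" "\<forall>w\<in>U. E w c \<longrightarrow> E w l"
    using strat by blast
  moreover from this have "bd a l" using c unfolding bounded_def by blast
  ultimately show ?thesis unfolding level_def by blast
qed

lemma level_prioL:
  "\<lbrakk>a \<in> U; s \<in> U; level U E s; \<not> E a a; bd a s; x \<in> U; E x a\<rbrakk> \<Longrightarrow>
    \<exists>r\<in>U. level U E r \<and> bd x r \<and> E r s"
  using level_member bounded_low level_low_btrans by blast

lemma level_prioH:
  "\<lbrakk>a \<in> U; s \<in> U; level U E s; E a a; bd a s; x \<in> U; \<not> E x a\<rbrakk> \<Longrightarrow>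
    \<exists>r\<in>U. level U E r \<and> bd x r \<and> E r s"
  using level_member bounded_high level_low_btrans by blast

lemma level_specL:
  assumes F: "F \<in> D" and s: "s \<in> U" "level U E s"
    and b: "\<forall>x\<in>U. F x \<longrightarrow> (\<exists>r\<in>U. level U E r \<and> bd x r \<and> E r s)"
  shows "\<exists>a\<in>U. \<not> E a a \<and> bd a s \<and> (\<forall>x\<in>U. F x \<longleftrightarrow> E x a)"
proof -
  obtain a where a: "a \<in> U" "\<not> E a a" "\<forall>x\<in>U. E x a \<longleftrightarrow> F x \<and> E x s"
    using sep[OF F s(1)] level_low_btrans(1)[OF s] by blast
  have "E x s" if "x \<in> U" "F x" for x
    using b that level_bpotent[OF s] level_low_btrans(1) by blast
  then show ?thesis using a unfolding bounded_def by blast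
qed

lemma level_specH:
  assumes F: "F \<in> D" and s: "s \<in> U" "level U E s"
    and b: "\<forall>x\<in>U. F x \<longrightarrow> (\<exists>r\<in>U. level U E r \<and> bd x r \<and> E r s)"
  shows "\<exists>a\<in>U. E a a \<and> bd a s \<and> (\<forall>x\<in>U. F x \<longleftrightarrow> \<not> E x a)"
proof -
  obtain a where a: "a \<in> U" "\<not> E a a" "bd a s" "\<forall>x\<in>U. F x \<longleftrightarrow> E x a"
    using level_specL[OF assms] by blast
  obtain c where c: "c \<in> U" "\<forall>x\<in>U. E x c \<longleftrightarrow> \<not> E x a" "E c c" using compl[OF a(1)] a(2) by blast
  have "\<forall>w\<in>U. E w a \<longrightarrow> E w s" using bounded_low[OF a(3)] a s level_low_btrans by blast
  then show ?thesis using a c unfolding bounded_def by blast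
qed

end

section \<open>Stages\<close>

definition before_in :: "'s set \<Rightarrow> ('s \<Rightarrow> 's \<Rightarrow> bool) \<Rightarrow> ('a \<Rightarrow> 's \<Rightarrow> bool) \<Rightarrow> 'a \<Rightarrow> 's \<Rightarrow> bool" where
  "before_in S lt fnd x s \<longleftrightarrow> (\<exists>r\<in>S. fnd x r \<and> lt r s)"

text \<open>\<open>D\<close> only has to contain the predicates listed here:
  \<open>comp_slices\<close> is for the history that belongs to a stage, \<open>comp_russell\<close>
  for the existence of a first stage.\<close>

locale bst =
  fixes U :: "'a set" and E :: "'a \<Rightarrow> 'a \<Rightarrow> bool" and D :: "('a \<Rightarrow> bool) set"
    and S :: "'s set" and lt :: "'s \<Rightarrow> 's \<Rightarrow> bool" and fnd :: "'a \<Rightarrow> 's \<Rightarrow> bool"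
    and Lw Hg :: "'a \<Rightarrow> bool"
  assumes ext: "\<lbrakk>a \<in> U; b \<in> U; \<And>x. x \<in> U \<Longrightarrow> E x a \<longleftrightarrow> E x b\<rbrakk> \<Longrightarrow> a = b"
    and lt_trans: "\<lbrakk>r \<in> S; s \<in> S; t \<in> S; lt r s; lt s t\<rbrakk> \<Longrightarrow> lt r t"
    and staging: "a \<in> U \<Longrightarrow> \<exists>s\<in>S. fnd a s"
    and cases: "a \<in> U \<Longrightarrow> Lw a \<or> Hg a"
    and prioL: "\<lbrakk>a \<in> U; s \<in> S; Lw a; fnd a s; x \<in> U; E x a\<rbrakk> \<Longrightarrow> before_in S lt fnd x s"
    and prioH: "\<lbrakk>a \<in> U; s \<in> S; Hg a; fnd a s; x \<in> U; \<not> E x a\<rbrakk> \<Longrightarrow> before_in S lt fnd x s"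
    and specL: "\<lbrakk>F \<in> D; s \<in> S; \<forall>x\<in>U. F x \<longrightarrow> before_in S lt fnd x s\<rbrakk> \<Longrightarrow>
      \<exists>a\<in>U. Lw a \<and> fnd a s \<and> (\<forall>x\<in>U. F x \<longleftrightarrow> E x a)"
    and specH: "\<lbrakk>F \<in> D; s \<in> S; \<forall>x\<in>U. F x \<longrightarrow> before_in S lt fnd x s\<rbrakk> \<Longrightarrow>
      \<exists>a\<in>U. Hg a \<and> fnd a s \<and> (\<forall>x\<in>U. F x \<longleftrightarrow> \<not> E x a)"
    and comp_mem: "a \<in> U \<Longrightarrow> \<exists>F\<in>D. \<forall>x\<in>U. F x \<longleftrightarrow> E x a"
    and comp_nonmem: "a \<in> U \<Longrightarrow> \<exists>F\<in>D. \<forall>x\<in>U. F x \<longleftrightarrow> \<not> E x a"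
    and comp_sep: "\<lbrakk>F \<in> D; a \<in> U\<rbrakk> \<Longrightarrow> \<exists>F'\<in>D. \<forall>x\<in>U. F' x \<longleftrightarrow> F x \<and> E x a"
    and comp_before: "s \<in> S \<Longrightarrow> \<exists>F\<in>D. \<forall>x\<in>U. F x \<longleftrightarrow> before_in S lt fnd x s"
    and comp_slices: "s \<in> S \<Longrightarrow> \<exists>F\<in>D. \<forall>x\<in>U. F x \<longleftrightarrow>
      (\<exists>r\<in>S. lt r s \<and> (\<forall>y\<in>U. E y x \<longleftrightarrow> before_in S lt fnd y r))"
    and comp_russell: "a \<in> U \<Longrightarrow> \<exists>F\<in>D. \<forall>x\<in>U. F x \<longleftrightarrow>
      \<not> E x x \<and> (\<forall>s\<in>S. fnd a s \<longrightarrow> before_in S lt fnd x s)"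
begin

abbreviation "bf \<equiv> before_in S lt fnd"

lemma beforeI: "\<lbrakk>r \<in> S; fnd x r; lt r s\<rbrakk> \<Longrightarrow> bf x s"
  by (auto simp: before_in_def)

text \<open>Specification yields a low set found at \<open>s\<close> with the members of
  \<open>x\<close>; by extensionality it is \<open>x\<close>. Early members thus force
  \<open>x\<close> itself to be found at \<open>s\<close>.\<close>

lemma found_low:
  assumes "x \<in> U" "s \<in> S" "\<forall>w\<in>U. E w x \<longrightarrow> bf w s"
  shows "Lw x \<and> fnd x s"
proof -
  obtain F where F: "F \<in> D" "\<forall>w\<in>U. F w \<longleftrightarrow> E w x" using comp_mem assms by blast
  then obtain a where a: "a \<in> U" "Lw a" "fnd a s" "\<forall>w\<in>U. F w \<longleftrightarrow> E w a"
    using specL[of F s] assms by blast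
  then have "a = x" using F assms by (intro ext) auto
  then show ?thesis using a by blast
qed

lemma found_high:
  assumes "x \<in> U" "s \<in> S" "\<forall>w\<in>U. \<not> E w x \<longrightarrow> bf w s"
  shows "Hg x \<and> fnd x s"
proof -
  obtain F where F: "F \<in> D" "\<forall>w\<in>U. F w \<longleftrightarrow> \<not> E w x" using comp_nonmem assms by blast
  then obtain a where a: "a \<in> U" "Hg a" "fnd a s" "\<forall>w\<in>U. F w \<longleftrightarrow> \<not> E w a"
    using specH[of F s] assms by blast
  then have "a = x" using F assms by (intro ext) auto
  then show ?thesis using a by blast
qed

lemma first_stage:
  assumes a: "a \<in> U"
  shows "\<exists>s\<in>S. fnd a s \<and> \<not> bf a s"
proof (rule ccontr)
  assume n: "\<not> ?thesis"
  obtain s0 where s0: "s0 \<in> S" "fnd a s0" using staging a by blast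
  obtain F where F: "F \<in> D" "\<forall>x\<in>U. F x \<longleftrightarrow> \<not> E x x \<and> (\<forall>s\<in>S. fnd a s \<longrightarrow> bf x s)"
    using comp_russell a by blast
  then obtain d where d: "d \<in> U" "\<forall>x\<in>U. F x \<longleftrightarrow> E x d" using specL[of F s0] s0 by blast
  \<comment> \<open>If \<open>d\<close> were found before every stage of \<open>a\<close>, it would
    be in itself exactly if it were not.\<close>
  then obtain s where s: "s \<in> S" "fnd a s" "\<not> bf d s" using F by blast
  then obtain r where r: "r \<in> S" "fnd a r" "lt r s" using n unfolding before_in_def by blast
  \<comment> \<open>Members of \<open>d\<close> are found before every stage of \<open>a\<close>, in
    particular before \<open>r\<close>. So \<open>d\<close> is found at \<open>r\<close>, hence
    before \<open>s\<close>.\<close>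
  then have "fnd d r" using found_low[of d r] d F by blast
  then show False using s r beforeI by blast
qed

text \<open>At a first stage of \<open>a\<close>, Priority excludes a low \<open>a\<close> in itself
  and a high \<open>a\<close> not in itself, since \<open>a\<close> would be found earlier.
  \<open>cases\<close> gives the converses.\<close>

lemma low_iff: "a \<in> U \<Longrightarrow> Lw a \<longleftrightarrow> \<not> E a a"
  and high_iff: "a \<in> U \<Longrightarrow> Hg a \<longleftrightarrow> E a a"
proof -
  assume a: "a \<in> U"
  then obtain s where s: "s \<in> S" "fnd a s" "\<not> bf a s" using first_stage by blast
  then show "Lw a \<longleftrightarrow> \<not> E a a" "Hg a \<longleftrightarrow> E a a" using cases[OF a] prioL prioH a by blast+
qed

lemma complement:
  assumes a: "a \<in> U"
  shows "\<exists>c\<in>U. (\<forall>x\<in>U. E x c \<longleftrightarrow> \<not> E x a) \<and> (\<not> E a a \<longleftrightarrow> E c c)"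
proof -
  obtain s where s: "s \<in> S" "fnd a s" using staging a by blast
  show ?thesis
  proof (cases "E a a")
    case False
    then have "Lw a" using low_iff a by blast
    obtain F where F: "F \<in> D" "\<forall>w\<in>U. F w \<longleftrightarrow> E w a" using comp_mem a by blast
    then have "\<forall>x\<in>U. F x \<longrightarrow> bf x s" using prioL[OF a s(1) \<open>Lw a\<close> s(2)] by blast
    then obtain c where "c \<in> U" "Hg c" "\<forall>x\<in>U. F x \<longleftrightarrow> \<not> E x c" using specH F s by blast
    then show ?thesis using F False high_iff by blast
  next
    case True
    then have "Hg a" using high_iff a by blast
    obtain F where F: "F \<in> D" "\<forall>w\<in>U. F w \<longleftrightarrow> \<not> E w a" using comp_nonmem a by blast
    then have "\<forall>x\<in>U. F x \<longrightarrow> bf x s" using prioH[OF a s(1) \<open>Hg a\<close> s(2)] by blast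
    then obtain c where "c \<in> U" "Lw c" "\<forall>x\<in>U. F x \<longleftrightarrow> E x c" using specL F s by blast
    then show ?thesis using F True low_iff by blast
  qed
qed

lemma separation:
  assumes F: "F \<in> D" and a: "a \<in> U" "\<not> E a a"
  shows "\<exists>b\<in>U. \<not> E b b \<and> (\<forall>x\<in>U. E x b \<longleftrightarrow> F x \<and> E x a)"
proof -
  obtain s where s: "s \<in> S" "fnd a s" using staging a by blast
  have "Lw a" using low_iff a by blast
  obtain G where G: "G \<in> D" "\<forall>w\<in>U. G w \<longleftrightarrow> F w \<and> E w a" using comp_sep F a by blast
  then have "\<forall>x\<in>U. G x \<longrightarrow> bf x s" using prioL[OF a(1) s(1) \<open>Lw a\<close> s(2)] by blast
  then obtain b where "b \<in> U" "Lw b" "\<forall>x\<in>U. G x \<longleftrightarrow> E x b" using specL G s by blast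
  then show ?thesis using G low_iff by blast
qed

definition slice :: "'s \<Rightarrow> 'a \<Rightarrow> bool" where
  "slice s v \<longleftrightarrow> (\<forall>y\<in>U. E y v \<longleftrightarrow> bf y s)"

lemma slice_exists: "s \<in> S \<Longrightarrow> \<exists>v\<in>U. slice s v"
  unfolding slice_def using comp_before[of s] specL[of _ s] by (metis (no_types, lifting))

lemma slice_found: "\<lbrakk>s \<in> S; v \<in> U; slice s v\<rbrakk> \<Longrightarrow> \<not> E v v \<and> fnd v s"
  using found_low[of v s] low_iff unfolding slice_def by blast

lemma found_bounded_slice:
  "\<lbrakk>s \<in> S; v \<in> U; slice s v; y \<in> U; fnd y s\<rbrakk> \<Longrightarrow> bounded U E y v"
  unfolding bounded_def slice_def using cases[of y] prioL[of y s] prioH[of y s] by blast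

text \<open>Members of \<open>c\<close> are found before \<open>p\<close>, so the members of
  \<open>y\<close>, or its non-members, are too.\<close>

lemma bounded_found:
  assumes "c \<in> U" "\<not> E c c" "p \<in> S" "fnd c p" "y \<in> U" "bounded U E y c"
  shows "fnd y p"
proof -
  have "bf w p" if "w \<in> U" "E w c" for w using prioL[of c p w] low_iff assms that by blast
  then show ?thesis
    using assms(6) found_low[OF assms(5,3)] found_high[OF assms(5,3)] unfolding bounded_def by blast
qed

lemma stratification:
  assumes a: "a \<in> U" "\<not> E a a"
  shows "\<exists>h\<in>U. \<exists>l\<in>U. history U E h \<and> bpot_of U E h l \<and> (\<forall>w\<in>U. E w a \<longrightarrow> E w l)"
proof -
  obtain s where s: "s \<in> S" "fnd a s" using staging a by blast
  obtain l where l: "l \<in> U" "slice s l" using slice_exists s by blast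
  obtain F where F: "F \<in> D" "\<forall>x\<in>U. F x \<longleftrightarrow> (\<exists>r\<in>S. lt r s \<and> slice r x)"
    using comp_slices[OF s(1)] unfolding slice_def by blast
  then have "\<forall>x\<in>U. F x \<longrightarrow> bf x s" using slice_found beforeI by blast
  then obtain h where h: "h \<in> U" "Lw h" "\<forall>x\<in>U. E x h \<longleftrightarrow> (\<exists>r\<in>S. lt r s \<and> slice r x)"
    using specL[OF F(1) s(1)] F(2) by blast
  \<comment> \<open>Proved for all stages up to and including \<open>s\<close>: below
    \<open>s\<close> this is the condition on members of \<open>h\<close>, at \<open>s\<close> it
    identifies \<open>l\<close> as \<open>bpot\<close> of \<open>h\<close>.\<close>
  have mem: "E y x \<longleftrightarrow> (\<exists>c\<in>U. (E c x \<and> E c h) \<and> \<not> E c c \<and> bounded U E y c)"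
    if r: "r \<in> S" "r = s \<or> lt r s" and x: "x \<in> U" "slice r x" and y: "y \<in> U" for r x y
  proof
    assume "E y x"
    then obtain q where q: "q \<in> S" "fnd y q" "lt q r"
      using x y unfolding slice_def before_in_def by blast
    obtain c where c: "c \<in> U" "slice q c" using slice_exists q by blast
    have "lt q s" using q r s lt_trans by blast
    then have "E c h" using h c q by blast
    moreover have "\<not> E c c" "fnd c q" using slice_found c q by auto
    moreover from this have "E c x" using x c q beforeI unfolding slice_def by blast
    ultimately show "\<exists>c\<in>U. (E c x \<and> E c h) \<and> \<not> E c c \<and> bounded U E y c"
      using found_bounded_slice c q y by blast
  next
    assume "\<exists>c\<in>U. (E c x \<and> E c h) \<and> \<not> E c c \<and> bounded U E y c"
    then obtain c where c: "c \<in> U" "E c x" "\<not> E c c" "bounded U E y c" by blast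
    then obtain p where p: "p \<in> S" "fnd c p" "lt p r" using x unfolding slice_def before_in_def by blast
    then have "fnd y p" using bounded_found c y by blast
    then show "E y x" using x y p beforeI unfolding slice_def by blast
  qed
  have "history U E h"
    unfolding history_def using low_iff[OF h(1)] h(2,3) mem by blast
  moreover have "bpot_of U E h l"
    unfolding bpot_of_def
  proof
    fix y assume y: "y \<in> U"
    \<comment> \<open>At \<open>s\<close>, \<open>mem\<close> asks for \<open>c\<close> in both
      \<open>l\<close> and \<open>h\<close>; the second membership implies the first.\<close>
    have "E c l" if "c \<in> U" "E c h" for c
      using that h l slice_found beforeI unfolding slice_def by blast
    then show "E y l \<longleftrightarrow> (\<exists>c\<in>U. E c h \<and> \<not> E c c \<and> bounded U E y c)"
      using mem[OF s(1) _ l y] by blast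
  qed
  moreover have "\<forall>w\<in>U. E w a \<longrightarrow> E w l"
    using prioL[OF a(1) s(1) _ s(2)] low_iff[OF a(1)] a(2) l unfolding slice_def by blast
  ultimately show ?thesis using h l by blast
qed

end

section \<open>From models to stages and levels\<close>

abbreviation sets :: "'a model \<Rightarrow> 'a set" where "sets M \<equiv> mdom M SSet"
abbreviation memb :: "'a model \<Rightarrow> 'a \<Rightarrow> 'a \<Rightarrow> bool" where "memb M a b \<equiv> mint M PMem [a, b]"
abbreviation classes :: "'a model \<Rightarrow> ('a \<Rightarrow> bool) set" where
  "classes M \<equiv> (\<lambda>R x. R [x]) ` mrel M [SSet]"

lemmas language_defs = L_mem_def L_BST_def sv_def tv_def Fv_def mem_def less_def found_def low_def
  high_def subs_def csubs_def before_def

lemmas BLT_defs = BLT_ext_def BLT_compl_def BLT_sep_def BLT_strat_def bcond_def bhist_def is_bpot_def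

lemmas BST_defs = BLT_ext_def BST_order_def BST_staging_def BST_cases_def BST_prioL_def
  BST_prioH_def BST_specL_def BST_specH_def

lemma BLT_wf_sentence: "q \<in> BLT \<Longrightarrow> wf L_mem q \<and> sentence q"
  unfolding BLT_def by (auto simp: sentence_def BLT_defs language_defs)

lemma BST_wf_sentence: "q \<in> BST \<Longrightarrow> wf L_BST q \<and> sentence q"
  unfolding BST_def by (auto simp: sentence_def BST_defs language_defs)

text \<open>A relation variable with a name absent from \<open>p\<close> satisfies the proviso of
  Comprehension; \<open>e\<close> and \<open>d\<close> supply the parameters.\<close>

lemma unary_comprehension:
  assumes H: "henkin L M" and o: "ok M e d" and p: "wf L p" and s: "SSet \<in> fst L"
  shows "\<exists>F\<in>classes M. \<forall>a\<in>sets M. F a \<longleftrightarrow> sat M (e(sv n := a)) d p"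
proof -
  obtain k where k: "k \<notin> nms p" using finite_nms ex_new_if_finite by blast
  define X :: var2 where "X = (k, [SSet])"
  have X: "X \<notin> fv2 p" using fv2_nms[of X p] k by (auto simp: X_def)
  have "valid M (comp_inst X [sv n] p)"
    using H p X s unfolding henkin_def by (auto simp: X_def sv_def)
  then have "sat M e d (comp_inst X [sv n] p)" using o unfolding valid_def by blast
  then obtain R where R: "R \<in> mrel M [SSet]"
    "\<forall>a\<in>sets M. R [a] \<longleftrightarrow> sat M (e(sv n := a)) (d(X := R)) p"
    by (auto simp: comp_inst_def Alls_def X_def sv_def)
  have "sat M e' (d(X := R)) p = sat M e' d p" for e'
    by (rule sat_cong) (use X in auto)
  then show ?thesis using R by (intro bexI[of _ "\<lambda>x. R [x]"]) auto
qed

section \<open>The axioms read in a model\<close>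

lemma sat_bcond:
  "sat M e d bcond \<longleftrightarrow> \<not> memb M (e (sv 5)) (e (sv 5)) \<and>
     bounded (sets M) (memb M) (e (sv 4)) (e (sv 5))"
  by (simp add: bcond_def bounded_def language_defs)

lemma sat_bhist: "sat M e d bhist \<longleftrightarrow> history (sets M) (memb M) (e (sv 1))"
  by (simp add: bhist_def sat_bcond history_def) (simp add: language_defs)

lemma sat_is_bpot: "sat M e d is_bpot \<longleftrightarrow> bpot_of (sets M) (memb M) (e (sv 1)) (e (sv 2))"
  by (simp add: is_bpot_def sat_bcond bpot_of_def) (simp add: language_defs)

lemma sat_BLT_strat:
  "sat M e d BLT_strat \<longleftrightarrow> (\<forall>a\<in>sets M. \<not> memb M a a \<longrightarrow> (\<exists>h\<in>sets M. \<exists>l\<in>sets M.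
     history (sets M) (memb M) h \<and> bpot_of (sets M) (memb M) h l \<and>
     (\<forall>w\<in>sets M. memb M w a \<longrightarrow> memb M w l)))"
  by (simp add: BLT_strat_def sat_bhist sat_is_bpot) (simp add: language_defs)

lemma sat_BLT_sep:
  "sat M e d BLT_sep \<longleftrightarrow> (\<forall>F\<in>classes M. \<forall>a\<in>sets M. \<not> memb M a a \<longrightarrow>
     (\<exists>b\<in>sets M. \<not> memb M b b \<and> (\<forall>x\<in>sets M. memb M x b \<longleftrightarrow> F x \<and> memb M x a)))"
  by (simp add: BLT_sep_def language_defs)

lemma sat_BLT_compl:
  "sat M e d BLT_compl \<longleftrightarrow> (\<forall>a\<in>sets M. \<exists>c\<in>sets M.
     (\<forall>x\<in>sets M. memb M x c \<longleftrightarrow> \<not> memb M x a) \<and> (\<not> memb M a a \<longleftrightarrow> memb M c c))"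
  by (simp add: BLT_compl_def language_defs)

lemma sat_BLT_ext:
  "sat M e d BLT_ext \<longleftrightarrow> (\<forall>a\<in>sets M. \<forall>b\<in>sets M.
     (\<forall>x\<in>sets M. memb M x a \<longleftrightarrow> memb M x b) \<longrightarrow> a = b)"
  by (simp add: BLT_ext_def language_defs)

lemma blt_model:
  assumes H: "henkin L_mem M" and T: "\<And>q. q \<in> BLT \<Longrightarrow> valid M q"
  shows "blt (sets M) (memb M) (classes M)"
proof -
  obtain e d where o: "ok M e d" using ok_exists[OF H] by blast
  have T': "sat M e d q" if "q \<in> BLT" for q using T[OF that] o unfolding valid_def by blast
  have comp: "\<exists>F\<in>classes M. \<forall>a\<in>sets M. F a \<longleftrightarrow> sat M (e(sv 1 := h, sv 0 := a)) d p"
    if "wf L_mem p" "h \<in> sets M" for p h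
    by (rule unary_comprehension[OF H]) (use that o in \<open>auto simp: L_mem_def sv_def intro!: ok_upd1\<close>)
  show ?thesis
  proof
    show "a = b" if "a \<in> sets M" "b \<in> sets M" "\<And>x. x \<in> sets M \<Longrightarrow> memb M x a \<longleftrightarrow> memb M x b" for a b
      using T'[of BLT_ext] that unfolding sat_BLT_ext by (auto simp: BLT_def)
    show "\<exists>c\<in>sets M. (\<forall>x\<in>sets M. memb M x c \<longleftrightarrow> \<not> memb M x a) \<and> (\<not> memb M a a \<longleftrightarrow> memb M c c)"
      if "a \<in> sets M" for a
      using T'[of BLT_compl] that unfolding sat_BLT_compl by (auto simp: BLT_def)
    show "\<exists>b\<in>sets M. \<not> memb M b b \<and> (\<forall>x\<in>sets M. memb M x b \<longleftrightarrow> F x \<and> memb M x a)"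
      if "F \<in> classes M" "a \<in> sets M" "\<not> memb M a a" for F a
    proof -
      have "sat M e d BLT_sep" using T' by (simp add: BLT_def)
      from bspec[OF bspec[OF this[unfolded sat_BLT_sep] that(1)] that(2)] that(3)
      show ?thesis by blast
    qed
    show "\<exists>h\<in>sets M. \<exists>l\<in>sets M. history (sets M) (memb M) h \<and>
        bpot_of (sets M) (memb M) h l \<and> (\<forall>w\<in>sets M. memb M w a \<longrightarrow> memb M w l)"
      if "a \<in> sets M" "\<not> memb M a a" for a
      using T'[of BLT_strat] that unfolding sat_BLT_strat by (auto simp: BLT_def)
    show "\<exists>F\<in>classes M. \<forall>x\<in>sets M. F x \<longleftrightarrow> memb M x a" if "a \<in> sets M" for a
      using comp[of "mem (sv 0) (sv 1)" a] that by (simp add: language_defs)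
    show "\<exists>F\<in>classes M. \<forall>x\<in>sets M. F x \<longleftrightarrow> \<not> memb M x x \<and>
        (\<forall>y\<in>sets M. memb M y h \<and> \<not> memb M y y \<and> \<not> btrans (sets M) (memb M) y \<longrightarrow> memb M x y)"
      if "h \<in> sets M" for h
    proof -
      \<comment> \<open>\<open>sv 1\<close> stands for \<open>h\<close>, \<open>sv 2\<close> for
        \<open>y\<close>, and \<open>?tr\<close> expresses \<open>btrans\<close> of
        \<open>y\<close>.\<close>
      let ?tr = "All1 (sv 3) (Imp (mem (sv 3) (sv 2))
          (Or (subs (sv 3) (sv 2) (sv 4)) (csubs (sv 3) (sv 2) (sv 4))))"
      let ?p = "And (Neg (mem (sv 0) (sv 0))) (All1 (sv 2) (Imp (And (mem (sv 2) (sv 1))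
          (And (Neg (mem (sv 2) (sv 2))) (Neg ?tr))) (mem (sv 0) (sv 2))))"
      have "wf L_mem ?p" by (simp add: language_defs)
      moreover have "sat M (e(sv 1 := h, sv 0 := x)) d ?p \<longleftrightarrow> \<not> memb M x x \<and>
        (\<forall>y\<in>sets M. memb M y h \<and> \<not> memb M y y \<and> \<not> btrans (sets M) (memb M) y \<longrightarrow> memb M x y)" for x
        unfolding btrans_def bounded_def by (simp add: language_defs)
      ultimately show ?thesis using comp[of ?p h] that by simp
    qed
  qed
qed

lemma bst_model:
  assumes H: "henkin L_BST M" and T: "\<And>q. q \<in> BST \<Longrightarrow> valid M q"
  shows "bst (sets M) (memb M) (classes M) (mdom M SStage) (\<lambda>r s. mint M PLess [r, s])
    (\<lambda>a s. mint M PFound [a, s]) (\<lambda>a. mint M PLow [a]) (\<lambda>a. mint M PHigh [a])"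
    (is "bst ?U ?E ?D ?S ?lt ?fnd ?Lw ?Hg")
proof -
  obtain e d where o: "ok M e d" using ok_exists[OF H] by blast
  have T': "sat M e d q" if "q \<in> BST" for q using T[OF that] o unfolding valid_def by blast
  let ?bf = "before_in ?S ?lt ?fnd"
  have comp: "\<exists>F\<in>?D. \<forall>a\<in>?U. F a \<longleftrightarrow> sat M (e'(sv 0 := a)) d' p"
    if "wf L_BST p" "ok M e' d'" for p e' d'
    by (rule unary_comprehension[OF H]) (use that in \<open>auto simp: L_BST_def\<close>)
  \<comment> \<open>\<open>before\<close> binds \<open>tv 9\<close>, so its arguments must be other
    variables.\<close>
  have bf: "sat M e' d' (before x s) \<longleftrightarrow> ?bf (e' x) (e' s)" if "s \<noteq> tv 9" "x \<noteq> tv 9" for e' d' x s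
    using that by (simp add: before_def before_in_def found_def less_def tv_def)
  have oS: "ok M (e(sv 1 := a)) d" if "a \<in> ?U" for a
    by (rule ok_upd1[OF o]) (use that in \<open>simp add: sv_def\<close>)
  have oT: "ok M (e(tv 1 := s)) d" if "s \<in> ?S" for s
    by (rule ok_upd1[OF o]) (use that in \<open>simp add: tv_def\<close>)
  have tv9 [simp]: "sv n \<noteq> tv m" "tv m \<noteq> sv n" "tv m = tv n \<longleftrightarrow> m = n" "sv m = sv n \<longleftrightarrow> m = n"
    "snd (sv n) = SSet" "snd (tv n) = SStage" for m n
    by (auto simp: sv_def tv_def)
  note atoms = mem_def less_def found_def low_def high_def Fv_def
  show ?thesis
  proof
    show "a = b" if "a \<in> ?U" "b \<in> ?U" "\<And>x. x \<in> ?U \<Longrightarrow> ?E x a \<longleftrightarrow> ?E x b" for a b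
      using T'[of BLT_ext] that unfolding sat_BLT_ext by (auto simp: BST_def)
    have "sat M e d BST_order \<longleftrightarrow> (\<forall>r\<in>?S. \<forall>s\<in>?S. \<forall>t\<in>?S. ?lt r s \<and> ?lt s t \<longrightarrow> ?lt r t)"
      by (simp add: BST_order_def atoms)
    moreover have "sat M e d BST_order" using T' by (simp add: BST_def)
    ultimately show "?lt r t" if "r \<in> ?S" "s \<in> ?S" "t \<in> ?S" "?lt r s" "?lt s t" for r s t
      using that by blast
    have "sat M e d BST_staging" using T' by (simp add: BST_def)
    then show "\<exists>s\<in>?S. ?fnd a s" if "a \<in> ?U" for a
      using that by (simp add: BST_staging_def atoms)
    have "sat M e d BST_cases" using T' by (simp add: BST_def)
    then show "?Lw a \<or> ?Hg a" if "a \<in> ?U" for a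
      using that by (simp add: BST_cases_def atoms)
    have "sat M e d BST_prioL" using T' by (simp add: BST_def)
    then show "?bf x s" if "a \<in> ?U" "s \<in> ?S" "?Lw a" "?fnd a s" "x \<in> ?U" "?E x a" for a s x
      using that by (simp add: BST_prioL_def atoms bf)
    have "sat M e d BST_prioH" using T' by (simp add: BST_def)
    then show "?bf x s" if "a \<in> ?U" "s \<in> ?S" "?Hg a" "?fnd a s" "x \<in> ?U" "\<not> ?E x a" for a s x
      using that by (simp add: BST_prioH_def atoms bf)
    have "sat M e d BST_specL" using T' by (simp add: BST_def)
    then show "\<exists>a\<in>?U. ?Lw a \<and> ?fnd a s \<and> (\<forall>x\<in>?U. F x \<longleftrightarrow> ?E x a)"
      if "F \<in> ?D" "s \<in> ?S" "\<forall>x\<in>?U. F x \<longrightarrow> ?bf x s" for F s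
      using that by (auto simp: BST_specL_def atoms bf)
    have "sat M e d BST_specH" using T' by (simp add: BST_def)
    then show "\<exists>a\<in>?U. ?Hg a \<and> ?fnd a s \<and> (\<forall>x\<in>?U. F x \<longleftrightarrow> \<not> ?E x a)"
      if "F \<in> ?D" "s \<in> ?S" "\<forall>x\<in>?U. F x \<longrightarrow> ?bf x s" for F s
      using that by (auto simp: BST_specH_def atoms bf)
    show "\<exists>F\<in>?D. \<forall>x\<in>?U. F x \<longleftrightarrow> ?E x a" if "a \<in> ?U" for a
      using comp[OF _ oS[OF that], of "mem (sv 0) (sv 1)"] by (simp add: L_BST_def atoms)
    show "\<exists>F\<in>?D. \<forall>x\<in>?U. F x \<longleftrightarrow> \<not> ?E x a" if "a \<in> ?U" for a
      using comp[OF _ oS[OF that], of "Neg (mem (sv 0) (sv 1))"] by (simp add: L_BST_def atoms)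
    show "\<exists>F'\<in>?D. \<forall>x\<in>?U. F' x \<longleftrightarrow> F x \<and> ?E x a" if "F \<in> ?D" "a \<in> ?U" for F a
    proof -
      obtain R where R: "R \<in> mrel M [SSet]" "F = (\<lambda>x. R [x])" using \<open>F \<in> ?D\<close> by blast
      have "ok M (e(sv 1 := a)) (d(Fv 0 := R))"
        by (rule ok_upd2[OF oS[OF \<open>a \<in> ?U\<close>]]) (use R in \<open>simp add: Fv_def\<close>)
      from comp[OF _ this, of "And (RApp (Fv 0) [sv 0]) (mem (sv 0) (sv 1))"]
      show ?thesis unfolding R(2) by (simp add: L_BST_def atoms)
    qed
    show "\<exists>F\<in>?D. \<forall>x\<in>?U. F x \<longleftrightarrow> ?bf x s" if "s \<in> ?S" for s
      using comp[OF _ oT[OF that], of "before (sv 0) (tv 1)"]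
      by (simp add: bf) (simp add: L_BST_def atoms before_def)
    show "\<exists>F\<in>?D. \<forall>x\<in>?U. F x \<longleftrightarrow> (\<exists>r\<in>?S. ?lt r s \<and> (\<forall>y\<in>?U. ?E y x \<longleftrightarrow> ?bf y r))" if "s \<in> ?S" for s
    proof -
      let ?p = "Ex1 (tv 0) (And (less (tv 0) (tv 1))
          (All1 (sv 2) (Iff (mem (sv 2) (sv 0)) (before (sv 2) (tv 0)))))"
      have "wf L_BST ?p" by (simp add: L_BST_def atoms before_def)
      from comp[OF this oT[OF that]] show ?thesis by (simp add: bf) (simp add: atoms)
    qed
    show "\<exists>F\<in>?D. \<forall>x\<in>?U. F x \<longleftrightarrow> \<not> ?E x x \<and> (\<forall>s\<in>?S. ?fnd a s \<longrightarrow> ?bf x s)" if "a \<in> ?U" for a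
    proof -
      let ?p = "And (Neg (mem (sv 0) (sv 0)))
          (All1 (tv 0) (Imp (found (sv 1) (tv 0)) (before (sv 0) (tv 0))))"
      have "wf L_BST ?p" by (simp add: L_BST_def atoms before_def)
      from comp[OF this oS[OF that]] show ?thesis by (simp add: bf) (simp add: atoms)
    qed
  qed
qed

lemma BST_proves_BLT:
  assumes "q \<in> BLT"
  shows "prv L_BST BST q"
proof (rule completeness)
  show "finite BST" by (simp add: BST_def)
  show "wf L_BST p \<and> sentence p" if "p \<in> BST" for p using BST_wf_sentence that .
  show "wf L_BST q" using assms unfolding BLT_def by (auto simp: BLT_defs language_defs)
  show "sentence q" using BLT_wf_sentence assms by blast
  fix M :: "var1 set model"
  assume H: "henkin L_BST M" and T: "\<And>q. q \<in> BST \<Longrightarrow> valid M q"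
  interpret bst "sets M" "memb M" "classes M" "mdom M SStage" "\<lambda>r s. mint M PLess [r, s]"
    "\<lambda>a s. mint M PFound [a, s]" "\<lambda>a. mint M PLow [a]" "\<lambda>a. mint M PHigh [a]"
    by (rule bst_model[OF H T])
  have "sat M e d BLT_ext" for e d unfolding sat_BLT_ext using ext by blast
  moreover have "sat M e d BLT_compl" for e d unfolding sat_BLT_compl using complement by blast
  moreover have "sat M e d BLT_sep" for e d unfolding sat_BLT_sep using separation by blast
  moreover have "sat M e d BLT_strat" for e d unfolding sat_BLT_strat using stratification by blast
  ultimately show "valid M q" using assms by (auto simp: valid_def BLT_def)
qed

section \<open>Interpreting stages as boolean levels\<close>

text \<open>Stages are certain sets, so a relation whose arity mentions stages is a relation on sets
  of the same length; its values outside the stages are never read.\<close>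

definition stage_model :: "'a model \<Rightarrow> 'a model" where
  "stage_model M = \<lparr>
     mdom = (\<lambda>s. case s of SSet \<Rightarrow> sets M | SStage \<Rightarrow> {l \<in> sets M. level (sets M) (memb M) l}),
     mrel = (\<lambda>ss. mrel M (map (\<lambda>_. SSet) ss)),
     mint = (\<lambda>p as. case p of
         PMem \<Rightarrow> mint M PMem as
       | PLess \<Rightarrow> mint M PMem as
       | PFound \<Rightarrow> bounded (sets M) (memb M) (as ! 0) (as ! 1)
       | PLow \<Rightarrow> \<not> memb M (as ! 0) (as ! 0)
       | PHigh \<Rightarrow> memb M (as ! 0) (as ! 0)) \<rparr>"

text \<open>Names below 10 are left free for the bound variables of the formulas for levels and inclusions.\<close>

definition vtr :: "var1 \<Rightarrow> var1" where
  "vtr x = sv (case snd x of SSet \<Rightarrow> 10 + 2 * fst x | SStage \<Rightarrow> 11 + 2 * fst x)"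

text \<open>Arities that differ only in their sorts become equal; coding the whole variable into the
  new name keeps such variables apart.\<close>

definition Vtr :: "var2 \<Rightarrow> var2" where
  "Vtr X = (to_nat X, map (\<lambda>_. SSet) (snd X))"

text \<open>\<open>is_bpot\<close> speaks of the fixed variable \<open>sv 2\<close>; equating it
  with \<open>y\<close> avoids a substitution.\<close>

definition lev :: "var1 \<Rightarrow> fm" where
  "lev y = Ex1 (sv 2) (And (Eq (sv 2) y) (Ex1 (sv 1) (And bhist is_bpot)))"

text \<open>Only stage quantifiers are relativized, to levels: \<open>stage_model\<close> takes over
  all relations on sets.\<close>

fun tr :: "fm \<Rightarrow> fm" where
  "tr (Prim p xs) = (case p of
      PMem \<Rightarrow> Prim PMem (map vtr xs)
    | PLess \<Rightarrow> Prim PMem (map vtr xs)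
    | PFound \<Rightarrow> Or (subs (vtr (xs ! 0)) (vtr (xs ! 1)) (sv 0)) (csubs (vtr (xs ! 0)) (vtr (xs ! 1)) (sv 0))
    | PLow \<Rightarrow> Neg (mem (vtr (xs ! 0)) (vtr (xs ! 0)))
    | PHigh \<Rightarrow> mem (vtr (xs ! 0)) (vtr (xs ! 0)))"
| "tr (Eq x y) = Eq (vtr x) (vtr y)"
| "tr (RApp X xs) = RApp (Vtr X) (map vtr xs)"
| "tr Bot = Bot"
| "tr (Imp p q) = Imp (tr p) (tr q)"
| "tr (All1 x p) = All1 (vtr x) (if snd x = SStage then Imp (lev (vtr x)) (tr p) else tr p)"
| "tr (All2 X p) = All2 (Vtr X) (tr p)"

lemma vtr_inj: "vtr x = vtr y \<longleftrightarrow> x = y"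
  by (cases x; cases y) (auto simp: vtr_def sv_def split: srt.splits, presburger+)

lemma Vtr_inj: "Vtr X = Vtr Y \<longleftrightarrow> X = Y"
  by (auto simp: Vtr_def)

lemma snd_sv: "snd (sv n) = SSet"
  by (simp add: sv_def)

lemma snd_vtr [simp]: "snd (vtr x) = SSet"
  by (simp add: vtr_def sv_def)

lemma vtr_neq [simp]: "n < 10 \<Longrightarrow> vtr x \<noteq> sv n" "n < 10 \<Longrightarrow> sv n \<noteq> vtr x"
  by (auto simp: vtr_def sv_def split: srt.splits)

lemma wf_lev: "snd y = SSet \<Longrightarrow> wf L_mem (lev y)"
  by (simp add: lev_def BLT_defs language_defs)

lemma wf_tr: "wf L_BST p \<Longrightarrow> wf L_mem (tr p)"
proof (induction p)
  case (Prim q xs)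
  then show ?case
    by (cases q) (auto simp: L_mem_def L_BST_def mem_def subs_def csubs_def sv_def)
next
  case (RApp X xs)
  then have X: "map snd xs = snd X" by simp
  have "map snd (map vtr xs) = map (\<lambda>_. SSet) (snd X)" unfolding X[symmetric] by simp
  then show ?case by (auto simp: Vtr_def L_mem_def)
qed (auto simp: L_mem_def wf_lev[unfolded L_mem_def] Vtr_def)

lemma fv2_tr: "fv2 (tr p) \<subseteq> Vtr ` fv2 p"
proof (induction p)
  case (Prim q xs)
  then show ?case by (cases q) (auto simp: mem_def subs_def csubs_def)
next
  case (All1 x p)
  then show ?case by (auto simp: lev_def BLT_defs language_defs)
qed auto

lemma sat_lev:
  assumes "e y \<in> sets M" and "y \<noteq> sv 2" "y \<noteq> sv 1"
  shows "sat M e d (lev y) \<longleftrightarrow> level (sets M) (memb M) (e y)"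
  using assms by (simp add: lev_def sat_bhist sat_is_bpot level_def) (simp add: sv_def)

lemma sat_tr: "wf L_BST p \<Longrightarrow> sat M e d (tr p) = sat (stage_model M) (e \<circ> vtr) (d \<circ> Vtr) p"
proof (induction p arbitrary: e d)
  case (Prim q xs)
  then have "length xs = length (prim_sig q)" by (metis length_map wf.simps(1))
  then show ?case
    by (cases q) (auto simp: stage_model_def mem_def subs_def csubs_def bounded_def comp_def
        length_Suc_conv snd_sv)
next
  case (All1 x p)
  have u: "(e(vtr x := a)) \<circ> vtr = (e \<circ> vtr)(x := a)" for a by (auto simp: fun_eq_iff vtr_inj)
  have IH: "sat M (e(vtr x := a)) d (tr p) = sat (stage_model M) ((e \<circ> vtr)(x := a)) (d \<circ> Vtr) p" for a
    using All1.IH[of "e(vtr x := a)" d] All1.prems unfolding u wf.simps by blast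
  show ?case
  proof (cases "snd x")
    case SSet
    then show ?thesis using IH by (simp add: stage_model_def del: fun_upd_apply comp_apply)
  next
    case SStage
    have "sat M (e(vtr x := a)) d (lev (vtr x)) \<longleftrightarrow> level (sets M) (memb M) a" if "a \<in> sets M" for a
      using sat_lev[of "e(vtr x := a)" "vtr x" M d] that by simp
    then show ?thesis using IH SStage
      by (auto simp: stage_model_def simp del: fun_upd_apply comp_apply)
  qed
next
  case (All2 X p)
  have u: "(d(Vtr X := R)) \<circ> Vtr = (d \<circ> Vtr)(X := R)" for R by (auto simp: fun_eq_iff Vtr_inj)
  have IH: "sat M e (d(Vtr X := R)) (tr p) = sat (stage_model M) (e \<circ> vtr) ((d \<circ> Vtr)(X := R)) p" for R
    using All2.IH[of e "d(Vtr X := R)"] All2.prems unfolding u wf.simps by blast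
  have "mrel (stage_model M) (snd X) = mrel M (snd (Vtr X))" by (simp add: stage_model_def Vtr_def)
  then show ?case using IH by (simp del: fun_upd_apply comp_apply)
qed (auto simp: comp_def)

lemma Alls_Cons: "Alls (x # xs) p = All1 x (Alls xs p)"
  by (simp add: Alls_def)

text \<open>The prefix on the left ranges over all sets, also for stage variables. Levels are among
  the sets, so it implies the prefix on the right.\<close>

lemma sat_Alls_tr:
  "wf L_BST q \<Longrightarrow> sat M e d (Alls (map vtr xs) (tr q)) \<Longrightarrow>
    sat (stage_model M) (e \<circ> vtr) (d \<circ> Vtr) (Alls xs q)"
proof (induction xs arbitrary: e)
  case Nil
  then have "sat M e d (tr q)" by (simp add: Alls_def)
  then have "sat (stage_model M) (e \<circ> vtr) (d \<circ> Vtr) q" using sat_tr Nil.prems(1) by blast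
  then show ?case by (simp only: Alls_def list.map foldr.simps id_apply)
next
  case (Cons x xs)
  have u: "(e(vtr x := a)) \<circ> vtr = (e \<circ> vtr)(x := a)" for a by (auto simp: fun_eq_iff vtr_inj)
  have "mdom (stage_model M) (snd x) \<subseteq> sets M" by (auto simp: stage_model_def split: srt.splits)
  moreover have "sat (stage_model M) ((e \<circ> vtr)(x := a)) (d \<circ> Vtr) (Alls xs q)" if "a \<in> sets M" for a
    using Cons.IH[of "e(vtr x := a)"] Cons.prems that unfolding u
    by (simp add: Alls_Cons del: fun_upd_apply comp_apply)
  ultimately show ?case by (auto simp: Alls_Cons simp del: fun_upd_apply comp_apply)
qed

text \<open>Comprehension for \<open>p\<close> is Comprehension in \<open>M\<close> for
  \<open>tr p\<close>. The existence of a level makes the sort of stages inhabited.\<close>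

lemma henkin_stage_model:
  assumes H: "henkin L_mem M" and lev: "\<exists>l\<in>sets M. level (sets M) (memb M) l"
  shows "henkin L_BST (stage_model M)"
proof -
  have "valid (stage_model M) (comp_inst X xs p)"
    if p: "wf L_BST p" "map snd xs = snd X" "distinct xs" "X \<notin> fv2 p" for p X xs
    unfolding valid_def
  proof (intro allI impI)
    fix e d assume o: "ok (stage_model M) e d"
    \<comment> \<open>Variables outside the range of the translation take their values from here, so
      that the transported environment is admissible in \<open>M\<close>.\<close>
    obtain e0 d0 where o0: "ok M e0 d0" using ok_exists[OF H] by blast
    define e' where "e' y = (if y \<in> range vtr then e (inv vtr y) else e0 y)" for y
    define d' where "d' Y = (if Y \<in> range Vtr then d (inv Vtr Y) else d0 Y)" for Y
    have inj: "inj vtr" "inj Vtr" by (auto intro: injI simp: vtr_inj Vtr_inj)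
    have e': "e' \<circ> vtr = e" and d': "d' \<circ> Vtr = d"
      using inj by (auto simp: fun_eq_iff e'_def d'_def)
    have "e' y \<in> mdom M (snd y)" for y
    proof (cases "y \<in> range vtr")
      case True
      then obtain x where x: "y = vtr x" by blast
      then have "e' y = e x" using e' by (metis comp_apply)
      then show ?thesis using ok_dom[OF o, of x] x
        by (auto simp: stage_model_def split: srt.splits)
    qed (simp add: e'_def ok_dom[OF o0])
    moreover have "d' Y \<in> mrel M (snd Y)" for Y
    proof (cases "Y \<in> range Vtr")
      case True
      then obtain X where x: "Y = Vtr X" by blast
      then have "d' Y = d X" using d' by (metis comp_apply)
      then show ?thesis using ok_rel[OF o, of X] x by (simp add: stage_model_def Vtr_def)
    qed (simp add: d'_def ok_rel[OF o0])
    ultimately have o': "ok M e' d'" by (simp add: ok_def)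
    let ?q = "Iff (RApp X xs) p"
    have "map snd (map vtr xs) = snd (Vtr X)"
      unfolding Vtr_def snd_conv p(2)[symmetric] by simp
    moreover have "set (snd (Vtr X)) \<subseteq> fst L_mem" by (auto simp: Vtr_def L_mem_def)
    moreover have "distinct (map vtr xs)"
      using p(3) inj by (simp add: distinct_map inj_on_def)
    moreover have "Vtr X \<notin> fv2 (tr p)" using fv2_tr[of p] p(4) by (auto simp: Vtr_inj)
    ultimately have "sat M e' d' (comp_inst (Vtr X) (map vtr xs) (tr p))"
      using H wf_tr[OF p(1)] o' unfolding henkin_def valid_def by blast
    moreover have "Iff (RApp (Vtr X) (map vtr xs)) (tr p) = tr ?q"
      by (simp add: Iff_def And_def Neg_def)
    ultimately obtain R where R: "R \<in> mrel M (snd (Vtr X))"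
      "sat M e' (d'(Vtr X := R)) (Alls (map vtr xs) (tr ?q))"
      by (auto simp: comp_inst_def)
    have u: "(d'(Vtr X := R)) \<circ> Vtr = d(X := R)" using d' by (auto simp: fun_eq_iff Vtr_inj)
    have "wf L_BST ?q" using p by (simp add: L_BST_def)
    then have "sat (stage_model M) e (d(X := R)) (Alls xs ?q)"
      using sat_Alls_tr[OF _ R(2)] unfolding u e' by blast
    then show "sat (stage_model M) e d (comp_inst X xs p)"
      using R(1) by (auto simp: comp_inst_def stage_model_def Vtr_def)
  qed
  moreover have "mdom (stage_model M) s \<noteq> {}" "mrel (stage_model M) ss \<noteq> {}" for s ss
    using H lev by (auto simp: stage_model_def henkin_def split: srt.splits)
  ultimately show ?thesis unfolding henkin_def by blast
qed

lemma sat_stage_model: "wf L_mem p \<Longrightarrow> sat (stage_model M) e d p = sat M e d p"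
proof (induction p arbitrary: e d)
  case (All2 X p)
  then have "set (snd X) \<subseteq> {SSet}" by (simp add: L_mem_def)
  then have "map (\<lambda>_. SSet) (snd X) = snd X" by (intro map_idI) auto
  then show ?case using All2 by (simp add: stage_model_def)
qed (auto simp: L_mem_def stage_model_def)

lemma stage_model_BST:
  assumes H: "henkin L_mem M" and T: "\<And>q. q \<in> BLT \<Longrightarrow> valid M q" and q: "q \<in> BST"
  shows "valid (stage_model M) q"
proof -
  interpret blt "sets M" "memb M" "classes M" by (rule blt_model[OF H T])
  let ?N = "stage_model M"
  have N [simp]: "mdom ?N SSet = sets M"
    "mdom ?N SStage = {l \<in> sets M. level (sets M) (memb M) l}"
    "mrel ?N [SSet] = mrel M [SSet]"
    "mint ?N PMem [a, b] = memb M a b" "mint ?N PLess [a, b] = memb M a b"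
    "mint ?N PFound [a, b] = bounded (sets M) (memb M) a b"
    "mint ?N PLow [a] = (\<not> memb M a a)" "mint ?N PHigh [a] = memb M a a" for a b
    by (simp_all add: stage_model_def)
  have tv9 [simp]: "sv n \<noteq> tv m" "tv m \<noteq> sv n" "tv m = tv n \<longleftrightarrow> m = n" "sv m = sv n \<longleftrightarrow> m = n"
    "snd (sv n) = SSet" "snd (tv n) = SStage" for m n
    by (auto simp: sv_def tv_def)
  note atoms = mem_def less_def found_def low_def high_def before_def Fv_def
  have "sat ?N e d BLT_ext" for e d
    using ext by (simp add: BLT_ext_def atoms)
  moreover have "sat ?N e d BST_order" for e d
    using level_trans by (simp add: BST_order_def atoms) blast
  moreover have "sat ?N e d BST_staging" for e d
    using level_staging by (simp add: BST_staging_def atoms) blast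
  moreover have "sat ?N e d BST_cases" for e d
    by (simp add: BST_cases_def atoms)
  moreover have "sat ?N e d BST_prioL" for e d
    using level_prioL by (simp add: BST_prioL_def atoms) blast
  moreover have "sat ?N e d BST_prioH" for e d
    using level_prioH by (simp add: BST_prioH_def atoms) blast
  moreover have "sat ?N e d BST_specL" for e d
  proof -
    have "\<exists>a\<in>sets M. \<not> memb M a a \<and> bd a s \<and> (\<forall>x\<in>sets M. R [x] \<longleftrightarrow> memb M x a)"
      if "R \<in> mrel M [SSet]" "s \<in> sets M" "level (sets M) (memb M) s"
        "\<forall>x\<in>sets M. R [x] \<longrightarrow> (\<exists>r. (r \<in> sets M \<and> level (sets M) (memb M) r) \<and> bd x r \<and> memb M r s)" for R s
      using level_specL[of "\<lambda>x. R [x]" s] that by blast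
    then show ?thesis by (simp add: BST_specL_def atoms)
  qed
  moreover have "sat ?N e d BST_specH" for e d
  proof -
    have "\<exists>a\<in>sets M. memb M a a \<and> bd a s \<and> (\<forall>x\<in>sets M. R [x] \<longleftrightarrow> \<not> memb M x a)"
      if "R \<in> mrel M [SSet]" "s \<in> sets M" "level (sets M) (memb M) s"
        "\<forall>x\<in>sets M. R [x] \<longrightarrow> (\<exists>r. (r \<in> sets M \<and> level (sets M) (memb M) r) \<and> bd x r \<and> memb M r s)" for R s
      using level_specH[of "\<lambda>x. R [x]" s] that by blast
    then show ?thesis by (simp add: BST_specH_def atoms)
  qed
  ultimately show ?thesis using q by (auto simp: valid_def BST_def)
qed

section \<open>From models back to provability\<close>

lemma wf_L_mem_L_BST: "wf L_mem p \<Longrightarrow> wf L_BST p"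
  by (induction p) (auto simp: L_mem_def L_BST_def)

lemma lax_L_mem_L_BST: "p \<in> lax L_mem \<Longrightarrow> p \<in> lax L_BST"
  by (induction rule: lax.induct) (rule lax.intros; auto simp: wf_L_mem_L_BST L_BST_def
      dest: wf_L_mem_L_BST)+

text \<open>Once the axioms of BLT are provable, derivations are copied step by step: logical axioms
  of the smaller language remain axioms, and BST consists of sentences, so generalization stays
  available.\<close>

lemma BST_extends_BLT: "prv L_mem BLT p \<Longrightarrow> prv L_BST BST p"
proof (induction rule: prv.induct)
  case (prv_ax p) then show ?case using lax_L_mem_L_BST prv.prv_ax by blast
next
  case (prv_hyp p) then show ?case by (rule BST_proves_BLT)
next
  case (prv_mp p q) then show ?case using prv.prv_mp by blast
next
  case (prv_gen1 p x)
  then show ?case using BST_wf_sentence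
    by (intro prv.prv_gen1) (auto simp: sentence_def L_BST_def)
next
  case (prv_gen2 p X)
  then show ?case using BST_wf_sentence
    by (intro prv.prv_gen2) (auto simp: sentence_def L_BST_def)
qed

theorem theorem3:
  assumes "wf L_mem \<phi>" and "sentence \<phi>"
  shows "prv L_BST BST \<phi> \<longleftrightarrow> prv L_mem BLT \<phi>"
proof
  assume prv: "prv L_BST BST \<phi>"
  show "prv L_mem BLT \<phi>"
  proof (rule completeness[OF _ BLT_wf_sentence assms])
    show "finite BLT" by (simp add: BLT_def)
    fix M :: "var1 set model"
    assume H: "henkin L_mem M" and T: "\<And>q. q \<in> BLT \<Longrightarrow> valid M q"
    interpret blt "sets M" "memb M" "classes M" by (rule blt_model[OF H T])
    \<comment> \<open>Any set has a level by \<open>level_staging\<close>, so there is at least one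
      stage.\<close>
    have "sets M \<noteq> {}" using H by (simp add: henkin_def)
    then have N: "henkin L_BST (stage_model M)"
      using henkin_stage_model[OF H] level_staging by blast
    have "valid (stage_model M) \<phi>"
      using soundness[OF N _ prv] stage_model_BST[OF H T] by blast
    moreover obtain e0 d0 where "ok (stage_model M) e0 d0" using ok_exists[OF N] by blast
    ultimately have "sat (stage_model M) e0 d0 \<phi>" by (simp add: valid_def)
    \<comment> \<open>The two models admit different environments, but a sentence has the same value
      in all of them.\<close>
    then show "valid M \<phi>"
      unfolding valid_def using sat_sentence[OF assms(2)] sat_stage_model[OF assms(1)] by metis
  qed
qed (rule BST_extends_BLT)

end
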